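(* Let $\Phi$ be a finite set of PDL formulas (without loaded formulas). Then $\Phi$ is consistent (there is no closed PDL-tableau for $\Phi$) if and only if $\Phi$ is satisfiable (true at some state of some Kripke model).
   Context: PDL syntax: $\phi ::= \bot \mid p \mid \lnot\phi \mid \phi\land\phi \mid [\alpha]\phi$, $\alpha ::= a \mid \tau? \mid \alpha\cup\beta \mid \alpha;\beta \mid \alpha^\ast$ ($a$ atomic programs), with standard Kripke semantics. For a list $\bar\delta=\delta_1\cdots\delta_n$ of programs, $\Box(\bar\delta,\phi)=[\delta_1]\cdots[\delta_n]\phi$ ($=\phi$ if $\bar\delta=\varepsilon$ is empty); juxtaposition is concatenation of lists. Unfolding boxes: the shallow tests are $\mathit{Tests}(a)=\emptyset$, $\mathit{Tests}(\tau?)=\{\tau\}$, $\mathit{Tests}(\alpha\cup\beta)=\mathit{Tests}(\alpha;\beta)=\mathit{Tests}(\alpha)\cup\mathit{Tests}(\beta)$, $\mathit{Tests}(\alpha^\ast)=\mathit{Tests}(\alpha)$. For a set $\ell$ of formulas define sets of program lists: $P^\ell(a)=\{a\}$; $P^\ell(\tau?)=\{\varepsilon\}$ if $\tau\in\ell$, $\emptyset$ otherwise; $P^\ell(\beta\cup\gamma)=P^\ell(\beta)\cup P^\ell(\gamma)$; $P^\ell(\beta;\gamma)=\{\bar\beta\gamma\mid\bar\beta\in P^\ell(\beta)\setminus\{\varepsilon\}\}\cup\{\bar\gamma\mid\bar\gamma\in P^\ell(\gamma),\varepsilon\in P^\ell(\beta)\}$; $P^\ell(\beta^\ast)=\{\varepsilon\}\cup\{\bar\beta\beta^\ast\mid\bar\beta\in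 P^\ell(\beta)\setminus\{\varepsilon\}\}$. Let $F^\ell(\alpha)=\{\lnot\tau\mid\tau\in\mathit{Tests}(\alpha),\tau\notin\ell\}$, $X^\ell_{\alpha,\psi}=F^\ell(\alpha)\cup\{\Box(\bar\alpha,\psi)\mid\bar\alpha\in P^\ell(\alpha)\}$ and $\mathsf{unfold}_\Box(\alpha,\psi)=\{X^\ell_{\alpha,\psi}\mid \ell\subseteq\mathit{Tests}(\alpha)\}$. Unfolding diamonds: $H_a=\{(\emptyset,a)\}$, $H_{\tau?}=\{(\{\tau\},\varepsilon)\}$, $H_{\alpha\cup\beta}=H_\alpha\cup H_\beta$, $H_{\alpha;\beta}=\{(X,\bar\delta\beta)\mid(X,\bar\delta)\in H_\alpha,\bar\delta\neq\varepsilon\}\cup\{(X\cup Y,\bar\delta)\mid(X,\varepsilon)\in H_\alpha,(Y,\bar\delta)\in H_\beta\}$, $H_{\alpha^\ast}=\{(\emptyset,\varepsilon)\}\cup\{(X,\bar\delta\alpha^\ast)\mid(X,\bar\delta)\in H_\alpha,\bar\delta\neq\varepsilon\}$; $\mathsf{unfold}_\Diamond(\alpha,\psi)=\{X\cup\{\lnot\Box(\bar\delta,\psi)\}\mid(X,\bar\delta)\in H_\alpha\}$. Loading: for each program $\alpha$ there is a marked copy $\underline{\alpha}$ (semantically identical to $\alpha$). A loaded formula has the form $\lnot[\underline{\alpha_1}]\cdots[\underline{\alpha_{n}}]\phi$ with $n\ge1$ and $\phi$ an unmarked PDL formula; a "possibly loaded box" $\xi$ is either a PDL formula or of the form $[\underline{\alpha_1}]\cdots[\underline{\alpha_k}]\phi$,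 $k\ge1$. $\underline{\Box}(\bar\delta,\xi)=[\underline{\delta_1}]\cdots[\underline{\delta_n}]\xi$ and $\underline{\mathsf{unfold}}_\Diamond(\alpha,\xi)=\{X\cup\{\lnot\underline{\Box}(\bar\delta,\xi)\}\mid(X,\bar\delta)\in H_\alpha\}$. A sequent is a finite set of (possibly loaded) formulas; it is loaded if it contains a loaded formula, free otherwise. It is basic if all its formulas have the form $\bot,\lnot\bot,p,\lnot p,[a]\phi$ or $\lnot[a]\phi$ with $a$ atomic. $\Delta_a=\{\phi\mid[a]\phi\in\Delta\}$. Rules (written parent / children; the principal formula is never in the context $\Delta$): $(\lnot)$ $\Delta,\lnot\lnot\phi\,/\,\Delta,\phi$; $(\land)$ $\Delta,\phi\land\psi\,/\,\Delta,\phi,\psi$; $(\lnot\land)$ $\Delta,\lnot(\phi\land\psi)\,/\,\Delta,\lnot\phi\mid\Delta,\lnot\psi$; $(\Box)$ $\Delta,[\alpha]\phi\,/\,\{\Delta\cup\Gamma\mid\Gamma\in\mathsf{unfold}_\Box(\alpha,\phi)\}$ for $\alpha$ non-atomic; $(\Diamond)$ $\Delta,\lnot[\alpha]\phi\,/\,\{\Delta\cup\Gamma\mid\Gamma\in\mathsf{unfold}_\Diamond(\alpha,\phi)\}$ for $\alpha$ non-atomic; $(\underline\Diamond)$ $\Delta,\lnot[\underline\alpha]\xi\,/\,\{\Delta\cup\Gamma\mid\Gamma\in\underline{\mathsf{unfold}}_\Diamond(\alpha,\xi)\}$ for $\alpha$ non-atomic; $(L+)$ $\Delta,\lnot[a][\alpha_1]\cdots[\alpha_n]\phi\,/\,\Delta,\lnot[\underline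 a][\underline{\alpha_1}]\cdots[\underline{\alpha_n}]\phi$ where $\Delta$ is free and basic and $n\ge0$ is maximal ($\phi$ not a box formula); $(L-)$ $\Delta,\lnot[\underline{\alpha_1}]\cdots[\underline{\alpha_n}]\phi\,/\,\Delta,\lnot[\alpha_1]\cdots[\alpha_n]\phi$ where $\Delta$ is basic and $n\ge1$; and the modal rule $(M)$ $\Delta,\lnot[\underline a]\xi\,/\,\Delta_a,\lnot\xi$ where $\Delta$ is basic. All rules except $(M)$ are local. Moreover $(L-)$ may not be applied to a node that was produced by $(L+)$. A tableau for $\Gamma$ is a finite-or-infinite rooted tree whose nodes are labelled by sequents, root labelled $\Gamma$, such that each interior node with its children is an instance of a rule. A repeat is a node $t$ whose label equals that of a proper ancestor; the nearest such ancestor is its companion. A repeat is a loaded-path repeat if all nodes on the path from its companion to it (inclusive) are loaded, and a free repeat if it is free. A PDL-tableau is a tableau in which every loaded-path repeat and every free repeat is a leaf. A node is closed if its label contains $\bot$ or both $\phi$ and $\lnot\phi$ for some $\phi$; a PDL-tableau is closed if every leaf is closed or a loaded-path repeat. *)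

theory Defs
  imports Main "HOL-Library.Sublist"
begin

section \<open>Syntax and Kripke semantics of PDL\<close>

datatype ('p, 'a) fm =
    Bot
  | Var 'p
  | Neg "('p, 'a) fm"
  | Con "('p, 'a) fm" "('p, 'a) fm"
  | Box "('p, 'a) prog" "('p, 'a) fm"
and ('p, 'a) prog =
    Atom 'a
  | Test "('p, 'a) fm"
  | Choice "('p, 'a) prog" "('p, 'a) prog"
  | Seq "('p, 'a) prog" "('p, 'a) prog"
  | Star "('p, 'a) prog"

record ('w, 'p, 'a) kripke =
  states :: "'w set"
  acc :: "'a \<Rightarrow> ('w \<times> 'w) set"
  val :: "'p \<Rightarrow> 'w set"

definition kripke_model :: "('w, 'p, 'a) kripke \<Rightarrow> bool" where
  "kripke_model M \<longleftrightarrow>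
     states M \<noteq> {} \<and>
     (\<forall>a. acc M a \<subseteq> states M \<times> states M) \<and>
     (\<forall>p. val M p \<subseteq> states M)"

text \<open>The restriction in the clause for \<open>Star\<close> is needed because \<open>rtrancl\<close> is reflexive on
  the whole type rather than on the set of states.\<close>

primrec sat :: "('w, 'p, 'a) kripke \<Rightarrow> ('p, 'a) fm \<Rightarrow> 'w \<Rightarrow> bool"
  and prel :: "('w, 'p, 'a) kripke \<Rightarrow> ('p, 'a) prog \<Rightarrow> ('w \<times> 'w) set" where
  "sat M Bot w \<longleftrightarrow> False"
| "sat M (Var p) w \<longleftrightarrow> w \<in> val M p"
| "sat M (Neg \<phi>) w \<longleftrightarrow> \<not> sat M \<phi> w"
| "sat M (Con \<phi> \<psi>) w \<longleftrightarrow> sat M \<phi> w \<and> sat M \<psi> w"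
| "sat M (Box \<alpha> \<phi>) w \<longleftrightarrow> (\<forall>v. (w, v) \<in> prel M \<alpha> \<longrightarrow> sat M \<phi> v)"
| "prel M (Atom a) = acc M a"
| "prel M (Test \<tau>) = {(w, w) | w. w \<in> states M \<and> sat M \<tau> w}"
| "prel M (Choice \<alpha> \<beta>) = prel M \<alpha> \<union> prel M \<beta>"
| "prel M (Seq \<alpha> \<beta>) = prel M \<alpha> O prel M \<beta>"
| "prel M (Star \<alpha>) = (prel M \<alpha>)\<^sup>* \<inter> states M \<times> states M"

text \<open>HOL cannot quantify over types inside a formula, so satisfiability is relative to the type
  from which the states of the model are drawn.\<close>

definition satisfiable :: "'w itself \<Rightarrow> ('p, 'a) fm set \<Rightarrow> bool" where
  "satisfiable (_ :: 'w itself) \<Phi> \<longleftrightarrow>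
     (\<exists>(M :: ('w, 'p, 'a) kripke) w.
        kripke_model M \<and> w \<in> states M \<and> (\<forall>\<phi>\<in>\<Phi>. sat M \<phi> w))"

section \<open>Unfolding\<close>

abbreviation boxes :: "('p, 'a) prog list \<Rightarrow> ('p, 'a) fm \<Rightarrow> ('p, 'a) fm" where
  "boxes \<delta> \<phi> \<equiv> foldr Box \<delta> \<phi>"

primrec tests :: "('p, 'a) prog \<Rightarrow> ('p, 'a) fm set" where
  "tests (Atom a) = {}"
| "tests (Test \<tau>) = {\<tau>}"
| "tests (Choice \<alpha> \<beta>) = tests \<alpha> \<union> tests \<beta>"
| "tests (Seq \<alpha> \<beta>) = tests \<alpha> \<union> tests \<beta>"
| "tests (Star \<alpha>) = tests \<alpha>"

primrec P :: "('p, 'a) fm set \<Rightarrow> ('p, 'a) prog \<Rightarrow> ('p, 'a) prog list set" where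
  "P l (Atom a) = {[Atom a]}"
| "P l (Test \<tau>) = (if \<tau> \<in> l then {[]} else {})"
| "P l (Choice \<beta> \<gamma>) = P l \<beta> \<union> P l \<gamma>"
| "P l (Seq \<beta> \<gamma>) =
     {\<delta> @ [\<gamma>] | \<delta>. \<delta> \<in> P l \<beta> - {[]}} \<union> {\<delta>. \<delta> \<in> P l \<gamma> \<and> [] \<in> P l \<beta>}"
| "P l (Star \<beta>) = {[]} \<union> {\<delta> @ [Star \<beta>] | \<delta>. \<delta> \<in> P l \<beta> - {[]}}"

definition F :: "('p, 'a) fm set \<Rightarrow> ('p, 'a) prog \<Rightarrow> ('p, 'a) fm set" where
  "F l \<alpha> = {Neg \<tau> | \<tau>. \<tau> \<in> tests \<alpha> \<and> \<tau> \<notin> l}"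

definition X :: "('p, 'a) fm set \<Rightarrow> ('p, 'a) prog \<Rightarrow> ('p, 'a) fm \<Rightarrow> ('p, 'a) fm set" where
  "X l \<alpha> \<psi> = F l \<alpha> \<union> {boxes \<delta> \<psi> | \<delta>. \<delta> \<in> P l \<alpha>}"

definition unfold_box :: "('p, 'a) prog \<Rightarrow> ('p, 'a) fm \<Rightarrow> ('p, 'a) fm set set" where
  "unfold_box \<alpha> \<psi> = {X l \<alpha> \<psi> | l. l \<subseteq> tests \<alpha>}"

primrec H :: "('p, 'a) prog \<Rightarrow> (('p, 'a) fm set \<times> ('p, 'a) prog list) set" where
  "H (Atom a) = {({}, [Atom a])}"
| "H (Test \<tau>) = {({\<tau>}, [])}"
| "H (Choice \<alpha> \<beta>) = H \<alpha> \<union> H \<beta>"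
| "H (Seq \<alpha> \<beta>) =
     {(Y, \<delta> @ [\<beta>]) | Y \<delta>. (Y, \<delta>) \<in> H \<alpha> \<and> \<delta> \<noteq> []} \<union>
     {(Y \<union> Z, \<delta>) | Y Z \<delta>. (Y, []) \<in> H \<alpha> \<and> (Z, \<delta>) \<in> H \<beta>}"
| "H (Star \<alpha>) = {({}, [])} \<union> {(Y, \<delta> @ [Star \<alpha>]) | Y \<delta>. (Y, \<delta>) \<in> H \<alpha> \<and> \<delta> \<noteq> []}"

definition unfold_dia :: "('p, 'a) prog \<Rightarrow> ('p, 'a) fm \<Rightarrow> ('p, 'a) fm set set" where
  "unfold_dia \<alpha> \<psi> = {Y \<union> {Neg (boxes \<delta> \<psi>)} | Y \<delta>. (Y, \<delta>) \<in> H \<alpha>}"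

section \<open>Loaded formulas and sequents\<close>

text \<open>A possibly loaded box is a block of marked boxes (possibly none) in front of a PDL formula.
  A sequent consists of PDL formulas \<open>Free \<phi>\<close> and loaded formulas; \<open>Loaded \<alpha> \<xi>\<close> is the
  negation of the marked box of \<open>\<alpha>\<close> in front of \<open>\<xi>\<close>.\<close>

datatype ('p, 'a) lbox =
    Plain "('p, 'a) fm"
  | LBox "('p, 'a) prog" "('p, 'a) lbox"

datatype ('p, 'a) sfm =
    Free "('p, 'a) fm"
  | Loaded "('p, 'a) prog" "('p, 'a) lbox"

type_synonym ('p, 'a) sequent = "('p, 'a) sfm set"

primrec lneg :: "('p, 'a) lbox \<Rightarrow> ('p, 'a) sfm" where
  "lneg (Plain \<phi>) = Free (Neg \<phi>)"
| "lneg (LBox \<alpha> \<xi>) = Loaded \<alpha> \<xi>"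

abbreviation lboxes :: "('p, 'a) prog list \<Rightarrow> ('p, 'a) lbox \<Rightarrow> ('p, 'a) lbox" where
  "lboxes \<delta> \<xi> \<equiv> foldr LBox \<delta> \<xi>"

definition unfold_ldia :: "('p, 'a) prog \<Rightarrow> ('p, 'a) lbox \<Rightarrow> ('p, 'a) sequent set" where
  "unfold_ldia \<alpha> \<xi> = {Free ` Y \<union> {lneg (lboxes \<delta> \<xi>)} | Y \<delta>. (Y, \<delta>) \<in> H \<alpha>}"

definition loaded :: "('p, 'a) sequent \<Rightarrow> bool" where
  "loaded \<Delta> \<longleftrightarrow> (\<exists>\<alpha> \<xi>. Loaded \<alpha> \<xi> \<in> \<Delta>)"

definition basic :: "('p, 'a) sequent \<Rightarrow> bool" where
  "basic \<Delta> \<longleftrightarrow>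
     (\<forall>f\<in>\<Delta>. f = Free Bot \<or> f = Free (Neg Bot) \<or>
        (\<exists>p. f = Free (Var p)) \<or> (\<exists>p. f = Free (Neg (Var p))) \<or>
        (\<exists>a \<phi>. f = Free (Box (Atom a) \<phi>)) \<or> (\<exists>a \<phi>. f = Free (Neg (Box (Atom a) \<phi>))))"

definition proj :: "'a \<Rightarrow> ('p, 'a) sequent \<Rightarrow> ('p, 'a) sequent" where
  "proj a \<Delta> = {Free \<phi> | \<phi>. Free (Box (Atom a) \<phi>) \<in> \<Delta>}"

definition atomic :: "('p, 'a) prog \<Rightarrow> bool" where
  "atomic \<alpha> \<longleftrightarrow> (\<exists>a. \<alpha> = Atom a)"

section \<open>Rules and tableaux\<close>

datatype rule_name = RNeg | RCon | RNegCon | RBox | RDia | RLDia | RLPlus | RLMinus | RM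

inductive rule_inst :: "rule_name \<Rightarrow> ('p, 'a) sequent \<Rightarrow> ('p, 'a) sequent set \<Rightarrow> bool" where
  neg: "Free (Neg (Neg \<phi>)) \<notin> \<Delta> \<Longrightarrow>
     rule_inst RNeg (\<Delta> \<union> {Free (Neg (Neg \<phi>))}) {\<Delta> \<union> {Free \<phi>}}"
| con: "Free (Con \<phi> \<psi>) \<notin> \<Delta> \<Longrightarrow>
     rule_inst RCon (\<Delta> \<union> {Free (Con \<phi> \<psi>)}) {\<Delta> \<union> {Free \<phi>, Free \<psi>}}"
| neg_con: "Free (Neg (Con \<phi> \<psi>)) \<notin> \<Delta> \<Longrightarrow>
     rule_inst RNegCon (\<Delta> \<union> {Free (Neg (Con \<phi> \<psi>))})
       {\<Delta> \<union> {Free (Neg \<phi>)}, \<Delta> \<union> {Free (Neg \<psi>)}}"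
| box: "Free (Box \<alpha> \<phi>) \<notin> \<Delta> \<Longrightarrow> \<not> atomic \<alpha> \<Longrightarrow>
     rule_inst RBox (\<Delta> \<union> {Free (Box \<alpha> \<phi>)}) {\<Delta> \<union> Free ` \<Gamma> | \<Gamma>. \<Gamma> \<in> unfold_box \<alpha> \<phi>}"
| dia: "Free (Neg (Box \<alpha> \<phi>)) \<notin> \<Delta> \<Longrightarrow> \<not> atomic \<alpha> \<Longrightarrow>
     rule_inst RDia (\<Delta> \<union> {Free (Neg (Box \<alpha> \<phi>))}) {\<Delta> \<union> Free ` \<Gamma> | \<Gamma>. \<Gamma> \<in> unfold_dia \<alpha> \<phi>}"
| ldia: "Loaded \<alpha> \<xi> \<notin> \<Delta> \<Longrightarrow> \<not> atomic \<alpha> \<Longrightarrow>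
     rule_inst RLDia (\<Delta> \<union> {Loaded \<alpha> \<xi>}) {\<Delta> \<union> \<Gamma> | \<Gamma>. \<Gamma> \<in> unfold_ldia \<alpha> \<xi>}"
| lplus: "Free (Neg (Box (Atom a) (boxes \<delta> \<phi>))) \<notin> \<Delta> \<Longrightarrow> \<not> loaded \<Delta> \<Longrightarrow> basic \<Delta> \<Longrightarrow>
     \<nexists>\<beta> \<psi>. \<phi> = Box \<beta> \<psi> \<Longrightarrow>
     rule_inst RLPlus (\<Delta> \<union> {Free (Neg (Box (Atom a) (boxes \<delta> \<phi>)))})
       {\<Delta> \<union> {Loaded (Atom a) (lboxes \<delta> (Plain \<phi>))}}"
| lminus: "\<delta> \<noteq> [] \<Longrightarrow> lneg (lboxes \<delta> (Plain \<phi>)) \<notin> \<Delta> \<Longrightarrow> basic \<Delta> \<Longrightarrow>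
     rule_inst RLMinus (\<Delta> \<union> {lneg (lboxes \<delta> (Plain \<phi>))}) {\<Delta> \<union> {Free (Neg (boxes \<delta> \<phi>))}}"
| modal: "Loaded (Atom a) \<xi> \<notin> \<Delta> \<Longrightarrow> basic \<Delta> \<Longrightarrow>
     rule_inst RM (\<Delta> \<union> {Loaded (Atom a) \<xi>}) {proj a \<Delta> \<union> {lneg \<xi>}}"

text \<open>The nodes of a tableau form a prefix-closed set of positions, the root being \<open>[]\<close>; hence
  the ancestors of a node are its prefixes. The component \<open>applied\<close> gives the name of the rule
  applied at an interior node and is irrelevant at leaves.\<close>

record ('p, 'a) tableau =
  nodes :: "nat list set"
  lab :: "nat list \<Rightarrow> ('p, 'a) sequent"
  applied :: "nat list \<Rightarrow> rule_name"

definition children :: "('p, 'a) tableau \<Rightarrow> nat list \<Rightarrow> nat list set" where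
  "children T s = {s @ [i] | i. s @ [i] \<in> nodes T}"

definition leaf :: "('p, 'a) tableau \<Rightarrow> nat list \<Rightarrow> bool" where
  "leaf T s \<longleftrightarrow> s \<in> nodes T \<and> children T s = {}"

definition interior :: "('p, 'a) tableau \<Rightarrow> nat list \<Rightarrow> bool" where
  "interior T s \<longleftrightarrow> s \<in> nodes T \<and> children T s \<noteq> {}"

definition tableau_for :: "('p, 'a) sequent \<Rightarrow> ('p, 'a) tableau \<Rightarrow> bool" where
  "tableau_for \<Gamma> T \<longleftrightarrow>
     [] \<in> nodes T \<and> (\<forall>s i. s @ [i] \<in> nodes T \<longrightarrow> s \<in> nodes T) \<and>
     (\<forall>s\<in>nodes T. finite (children T s) \<and> finite (lab T s)) \<and>
     lab T [] = \<Gamma> \<and>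
     (\<forall>s. interior T s \<longrightarrow> rule_inst (applied T s) (lab T s) (lab T ` children T s)) \<and>
     (\<forall>s t. interior T s \<and> t \<in> children T s \<and> interior T t \<and> applied T s = RLPlus
        \<longrightarrow> applied T t \<noteq> RLMinus)"

definition repeat :: "('p, 'a) tableau \<Rightarrow> nat list \<Rightarrow> bool" where
  "repeat T s \<longleftrightarrow> s \<in> nodes T \<and> (\<exists>c. strict_prefix c s \<and> lab T c = lab T s)"

definition companion :: "('p, 'a) tableau \<Rightarrow> nat list \<Rightarrow> nat list \<Rightarrow> bool" where
  "companion T s c \<longleftrightarrow>
     s \<in> nodes T \<and> strict_prefix c s \<and> lab T c = lab T s \<and>
     (\<forall>d. strict_prefix c d \<and> strict_prefix d s \<longrightarrow> lab T d \<noteq> lab T s)"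

definition loaded_path_repeat :: "('p, 'a) tableau \<Rightarrow> nat list \<Rightarrow> bool" where
  "loaded_path_repeat T s \<longleftrightarrow>
     (\<exists>c. companion T s c \<and> (\<forall>d. prefix c d \<and> prefix d s \<longrightarrow> loaded (lab T d)))"

definition free_repeat :: "('p, 'a) tableau \<Rightarrow> nat list \<Rightarrow> bool" where
  "free_repeat T s \<longleftrightarrow> repeat T s \<and> \<not> loaded (lab T s)"

definition pdl_tableau_for :: "('p, 'a) sequent \<Rightarrow> ('p, 'a) tableau \<Rightarrow> bool" where
  "pdl_tableau_for \<Gamma> T \<longleftrightarrow>
     tableau_for \<Gamma> T \<and> (\<forall>s. loaded_path_repeat T s \<or> free_repeat T s \<longrightarrow> leaf T s)"

definition closed_sequent :: "('p, 'a) sequent \<Rightarrow> bool" where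
  "closed_sequent \<Delta> \<longleftrightarrow> Free Bot \<in> \<Delta> \<or> (\<exists>\<phi>. Free \<phi> \<in> \<Delta> \<and> Free (Neg \<phi>) \<in> \<Delta>)"

definition closed_tableau :: "('p, 'a) tableau \<Rightarrow> bool" where
  "closed_tableau T \<longleftrightarrow>
     (\<forall>s. leaf T s \<longrightarrow> closed_sequent (lab T s) \<or> loaded_path_repeat T s)"

definition consistent :: "('p, 'a) fm set \<Rightarrow> bool" where
  "consistent \<Phi> \<longleftrightarrow> \<not> (\<exists>T. pdl_tableau_for (Free ` \<Phi>) T \<and> closed_tableau T)"

end

theory Submission
  imports Defs "HOL-Library.Multiset"
begin

text \<open>Soundness: in a model whose atomic steps increase a rank by one, a satisfied loaded formula
  has a witnessing run whose length never grows while one descends through satisfied children, and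
  shrinks at every modal step. The remaining rules on a loaded path terminate, so jumping from
  loaded-path repeats to their companions cannot go on forever; the descent has to leave the loaded
  part for a satisfied free node further down. As branches are finite, this is absurd. An arbitrary
  model is turned into a ranked one by pairing states with a step counter.

  Completeness: seen as a game, the prover wins an infinite play that stays loaded (it contains a
  loaded-path repeat), and any other play only by closing it. The free sequents won by the prover
  thus form a least fixed point over a greatest fixed point of loaded sequents. A positional winning
  strategy along which the stages of free sequents decrease unravels to a closed tableau. In the
  complement, the basic free sequents are the states of a model in which \<open>a\<close> relates \<open>s\<close> to \<open>t\<close>
  iff \<open>t\<close> locally entails every \<open>\<phi>\<close> with \<open>[a]\<phi>\<close> in \<open>s\<close>. The loaded sequents of the complement
  form a least fixed point, which is why diamonds over iterations are realised after finitely many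
  steps.\<close>

text \<open>A loaded-path repeat counts as closed, while a free repeat is a leaf that still has to
  be closed. Returning to a loaded sequent is thus a win for the prover only if no free sequent lies
  in between, and returning to a free one is of no use. This asymmetry dictates the nesting of the
  two fixed points and the use of stages. Program relations forget how long a run is. With a rank
  the number of atomic steps of a run is the difference of the ranks of its endpoints, so the
  descent can be measured without speaking of runs as objects. States of the model are basic
  sequents, not maximal consistent sets: at a state a test may be neither derivable nor refutable.
  Its truth is only known to lie between derivability of the test and underivability of its
  negation. Diamonds are therefore realised along the smaller of the two resulting relations, and
  boxes are respected along the larger one.\<close>

lemma prog_induct [case_names Atom Test Choice Seq Star]:
  assumes "\<And>a. Q (Atom a)" "\<And>\<tau>. Q (Test \<tau>)"
    "\<And>\<alpha> \<beta>. Q \<alpha> \<Longrightarrow> Q \<beta> \<Longrightarrow> Q (Choice \<alpha> \<beta>)"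
    "\<And>\<alpha> \<beta>. Q \<alpha> \<Longrightarrow> Q \<beta> \<Longrightarrow> Q (Seq \<alpha> \<beta>)"
    "\<And>\<alpha>. Q \<alpha> \<Longrightarrow> Q (Star \<alpha>)"
  shows "Q \<alpha>"
  by (rule prog.induct[of "\<lambda>_. True" Q]) (simp_all add: assms)

section \<open>Programs as relations with an arbitrary test predicate\<close>

text \<open>The completeness proof uses two test predicates besides truth: derivability of the test and
  underivability of its negation.\<close>

primrec rel :: "'w set \<Rightarrow> ('a \<Rightarrow> ('w \<times> 'w) set) \<Rightarrow> (('p, 'a) fm \<Rightarrow> 'w \<Rightarrow> bool)
    \<Rightarrow> ('p, 'a) prog \<Rightarrow> ('w \<times> 'w) set" where
  "rel S R T (Atom a) = R a"
| "rel S R T (Test \<tau>) = {(w, w) | w. w \<in> S \<and> T \<tau> w}"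
| "rel S R T (Choice \<alpha> \<beta>) = rel S R T \<alpha> \<union> rel S R T \<beta>"
| "rel S R T (Seq \<alpha> \<beta>) = rel S R T \<alpha> O rel S R T \<beta>"
| "rel S R T (Star \<alpha>) = (rel S R T \<alpha>)\<^sup>* \<inter> S \<times> S"

primrec rels :: "'w set \<Rightarrow> ('a \<Rightarrow> ('w \<times> 'w) set) \<Rightarrow> (('p, 'a) fm \<Rightarrow> 'w \<Rightarrow> bool)
    \<Rightarrow> ('p, 'a) prog list \<Rightarrow> ('w \<times> 'w) set" where
  "rels S R T [] = Id"
| "rels S R T (\<alpha> # \<delta>) = rel S R T \<alpha> O rels S R T \<delta>"

lemma prel_eq_rel: "prel M \<alpha> = rel (states M) (acc M) (sat M) \<alpha>"
  by (induction \<alpha> rule: prog_induct) auto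

abbreviation prels :: "('w, 'p, 'a) kripke \<Rightarrow> ('p, 'a) prog list \<Rightarrow> ('w \<times> 'w) set" where
  "prels M \<equiv> rels (states M) (acc M) (sat M)"

lemma rels_append: "rels S R T (\<delta> @ \<eta>) = rels S R T \<delta> O rels S R T \<eta>"
  by (induction \<delta>) auto

lemma rel_in_states:
  assumes "\<forall>a. R a \<subseteq> S \<times> S"
  shows "rel S R T \<alpha> \<subseteq> S \<times> S"
proof (induction \<alpha> rule: prog_induct)
  case (Atom a)
  show ?case using assms by simp
qed auto

lemma rels_in_states:
  assumes "\<forall>a. R a \<subseteq> S \<times> S" "(w, v) \<in> rels S R T \<delta>" "w \<in> S"
  shows "v \<in> S"
  using assms(2,3)
proof (induction \<delta> arbitrary: w)
  case (Cons \<alpha> \<delta>)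
  then obtain u where "(w, u) \<in> rel S R T \<alpha>" "(u, v) \<in> rels S R T \<delta>" by auto
  moreover then have "u \<in> S" using rel_in_states[OF assms(1)] by blast
  ultimately show ?case using Cons.IH by blast
qed simp

lemma rel_mono:
  assumes "\<And>\<tau> w. \<tau> \<in> tests \<alpha> \<Longrightarrow> w \<in> S \<Longrightarrow> T \<tau> w \<Longrightarrow> T' \<tau> w"
  shows "rel S R T \<alpha> \<subseteq> rel S R T' \<alpha>"
  using assms
proof (induction \<alpha> rule: prog_induct)
  case (Choice \<alpha> \<beta>)
  then have "rel S R T \<alpha> \<subseteq> rel S R T' \<alpha>" "rel S R T \<beta> \<subseteq> rel S R T' \<beta>" by auto
  then show ?case by auto
next
  case (Seq \<alpha> \<beta>)
  then have "rel S R T \<alpha> \<subseteq> rel S R T' \<alpha>" "rel S R T \<beta> \<subseteq> rel S R T' \<beta>" by auto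
  then show ?case by auto
next
  case (Star \<alpha>)
  then have "rel S R T \<alpha> \<subseteq> rel S R T' \<alpha>" by auto
  then have "(rel S R T \<alpha>)\<^sup>* \<subseteq> (rel S R T' \<alpha>)\<^sup>*" by (rule rtrancl_mono)
  then show ?case by auto
qed auto

lemma rels_mono:
  assumes "\<And>\<alpha> \<tau> w. \<alpha> \<in> set \<delta> \<Longrightarrow> \<tau> \<in> tests \<alpha> \<Longrightarrow> w \<in> S \<Longrightarrow> T \<tau> w \<Longrightarrow> T' \<tau> w"
  shows "rels S R T \<delta> \<subseteq> rels S R T' \<delta>"
  using assms
proof (induction \<delta>)
  case (Cons \<alpha> \<delta>)
  have "rel S R T \<alpha> \<subseteq> rel S R T' \<alpha>" by (rule rel_mono) (use Cons.prems in auto)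
  moreover have "rels S R T \<delta> \<subseteq> rels S R T' \<delta>" by (rule Cons.IH) (use Cons.prems in auto)
  ultimately show ?case by auto
qed auto

lemma sat_boxes: "sat M (boxes \<delta> \<phi>) w \<longleftrightarrow> (\<forall>v. (w, v) \<in> prels M \<delta> \<longrightarrow> sat M \<phi> v)"
  by (induction \<delta> arbitrary: w) (auto simp: prel_eq_rel)

section \<open>Unfolding is semantically adequate\<close>

text \<open>Every clause that appends a program does so behind a nonempty list, so the head stays
  the first atomic step of a run. Unfolding hence ends in a box of an atomic program or in the
  formula behind the unfolded box.\<close>

lemma H_head: "(Y, \<delta>) \<in> H \<alpha> \<Longrightarrow> \<delta> = [] \<or> (\<exists>a \<eta>. \<delta> = Atom a # \<eta>)"
  by (induction \<alpha> arbitrary: Y \<delta> rule: prog_induct) fastforce+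

lemma H_tests: "(Y, \<delta>) \<in> H \<alpha> \<Longrightarrow> Y \<subseteq> tests \<alpha>"
  by (induction \<alpha> arbitrary: Y \<delta> rule: prog_induct) fastforce+

text \<open>\<open>P\<close> and \<open>H\<close> build lists by parallel clauses; the tests that
  \<open>P\<close> looks up in \<open>l\<close> are those that \<open>H\<close> collects. Facts
  about box unfolding are thereby reduced to facts about \<open>H\<close>.\<close>

lemma P_imp_H: "\<delta> \<in> P l \<alpha> \<Longrightarrow> \<exists>Y\<subseteq>l. (Y, \<delta>) \<in> H \<alpha>"
proof (induction \<alpha> arbitrary: \<delta> rule: prog_induct)
  case (Seq \<alpha> \<beta>)
  from Seq.prems consider \<eta> where "\<delta> = \<eta> @ [\<beta>]" "\<eta> \<in> P l \<alpha>" "\<eta> \<noteq> []"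
    | "\<delta> \<in> P l \<beta>" "[] \<in> P l \<alpha>" by auto
  then show ?case
  proof cases
    case 1
    then show ?thesis using Seq.IH(1)[of \<eta>] by auto
  next
    case 2
    then obtain Y Z where "Y \<subseteq> l" "Z \<subseteq> l" "(Y, []) \<in> H \<alpha>" "(Z, \<delta>) \<in> H \<beta>"
      using Seq.IH(1)[of "[]"] Seq.IH(2)[of \<delta>] by auto
    then have "Y \<union> Z \<subseteq> l" "(Y \<union> Z, \<delta>) \<in> H (Seq \<alpha> \<beta>)" by auto
    then show ?thesis by blast
  qed
next
  case (Star \<alpha>)
  then show ?case by auto
qed (auto split: if_splits, metis+)

lemma finite_tests: "finite (tests \<alpha>)"
  by (induction \<alpha> rule: prog_induct) auto

lemma finite_H: "finite (H \<alpha>)"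
proof (induction \<alpha> rule: prog_induct)
  case (Seq \<alpha> \<beta>)
  have "H (Seq \<alpha> \<beta>) \<subseteq> (\<lambda>(Y, \<delta>). (Y, \<delta> @ [\<beta>])) ` H \<alpha> \<union>
      (\<lambda>((Y, \<eta>), (Z, \<delta>)). (Y \<union> Z, \<delta>)) ` (H \<alpha> \<times> H \<beta>)"
    by (force simp: image_iff)
  then show ?case using Seq by (meson finite_SigmaI finite_UnI finite_imageI finite_subset)
next
  case (Star \<alpha>)
  have "H (Star \<alpha>) \<subseteq> insert ({}, []) ((\<lambda>(Y, \<delta>). (Y, \<delta> @ [Star \<alpha>])) ` H \<alpha>)"
    by (force simp: image_iff)
  then show ?case using Star by (meson finite_insert finite_imageI finite_subset)
qed auto

lemma finite_P: "finite (P l \<alpha>)"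
proof -
  have "P l \<alpha> \<subseteq> snd ` H \<alpha>" using P_imp_H by force
  then show ?thesis using finite_H finite_subset by blast
qed

lemma H_nonempty: "H \<alpha> \<noteq> {}"
proof (induction \<alpha> rule: prog_induct)
  case (Seq \<alpha> \<beta>)
  obtain Y \<delta> Z \<eta> where "(Y, \<delta>) \<in> H \<alpha>" "(Z, \<eta>) \<in> H \<beta>" using Seq by fastforce
  then show ?case by (cases "\<delta> = []") auto
qed auto

text \<open>A run is split at its first atomic step. All tests passed before that step are evaluated
  at \<open>w\<close>, which is why a set of tests at the initial point suffices.\<close>

lemma H_complete:
  assumes RS: "\<forall>a. R a \<subseteq> S \<times> S" and "(w, v) \<in> rel S R T \<alpha>"
  shows "\<exists>Y \<delta>. (Y, \<delta>) \<in> H \<alpha> \<and> (\<forall>\<tau>\<in>Y. T \<tau> w) \<and> (w, v) \<in> rels S R T \<delta>"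
  using assms(2)
proof (induction \<alpha> arbitrary: w v rule: prog_induct)
  case (Choice \<alpha> \<beta>)
  then show ?case by (simp) blast
next
  case (Seq \<alpha> \<beta>)
  from Seq.prems obtain u where u: "(w, u) \<in> rel S R T \<alpha>" "(u, v) \<in> rel S R T \<beta>" by auto
  from Seq.IH(1)[OF u(1)] obtain Y \<delta> where Y: "(Y, \<delta>) \<in> H \<alpha>" "\<forall>\<tau>\<in>Y. T \<tau> w"
    "(w, u) \<in> rels S R T \<delta>" by blast
  show ?case
  proof (cases "\<delta> = []")
    case True
    from Seq.IH(2)[OF u(2)] obtain Z \<eta> where Z: "(Z, \<eta>) \<in> H \<beta>" "\<forall>\<tau>\<in>Z. T \<tau> u"
      "(u, v) \<in> rels S R T \<eta>" by blast
    have "(Y \<union> Z, \<eta>) \<in> H (Seq \<alpha> \<beta>)" using Y Z True by auto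
    moreover have "\<forall>\<tau>\<in>Y \<union> Z. T \<tau> w" "(w, v) \<in> rels S R T \<eta>" using Y Z True by auto
    ultimately show ?thesis by blast
  next
    case False
    have "(Y, \<delta> @ [\<beta>]) \<in> H (Seq \<alpha> \<beta>)" using Y False by auto
    moreover have "(w, v) \<in> rels S R T (\<delta> @ [\<beta>])" using Y u by (auto simp: rels_append)
    ultimately show ?thesis using Y by blast
  qed
next
  case (Star \<alpha>)
  then have "(w, v) \<in> (rel S R T \<alpha>)\<^sup>*" and S: "v \<in> S" by auto
  then show ?case
  proof (induction rule: converse_rtrancl_induct)
    case base
    have "({}, []) \<in> H (Star \<alpha>)" by simp
    then show ?case by fastforce
  next
    case (step w u)
    from Star.IH[OF step.hyps(1)] obtain Y \<delta> where Y: "(Y, \<delta>) \<in> H \<alpha>" "\<forall>\<tau>\<in>Y. T \<tau> w"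
      "(w, u) \<in> rels S R T \<delta>" by blast
    have u: "u \<in> S" using step.hyps(1) rel_in_states[OF RS] by blast
    show ?case
    proof (cases "\<delta> = []")
      \<comment> \<open>An iteration with an empty list does not leave \<open>w\<close>, so
        \<open>u = w\<close> and the hypothesis for the remaining run applies. This justifies that
        the clause of \<open>H\<close> for \<open>Star\<close> discards empty lists of the
        body.\<close>
      case True
      then show ?thesis using Y step.IH S by auto
    next
      case False
      have "(Y, \<delta> @ [Star \<alpha>]) \<in> H (Star \<alpha>)" using Y False by auto
      moreover have "(w, v) \<in> rels S R T (\<delta> @ [Star \<alpha>])"
        using Y step.hyps u S by (auto simp: rels_append)
      ultimately show ?thesis using Y by blast
    qed
  qed
qed auto

text \<open>The empty list denotes the identity on the whole type, while \<open>Test\<close> and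
  \<open>Star\<close> are confined to \<open>S\<close>; hence the assumption on the initial
  point.\<close>

lemma H_sound:
  assumes RS: "\<forall>a. R a \<subseteq> S \<times> S" and "w \<in> S"
    and "(Y, \<delta>) \<in> H \<alpha>" "\<forall>\<tau>\<in>Y. T \<tau> w" "(w, v) \<in> rels S R T \<delta>"
  shows "(w, v) \<in> rel S R T \<alpha>"
  using assms(3-)
proof (induction \<alpha> arbitrary: Y \<delta> v rule: prog_induct)
  case (Seq \<alpha> \<beta>)
  from Seq.prems(1) consider \<eta> where "\<delta> = \<eta> @ [\<beta>]" "(Y, \<eta>) \<in> H \<alpha>"
    | Y' Z where "Y = Y' \<union> Z" "(Y', []) \<in> H \<alpha>" "(Z, \<delta>) \<in> H \<beta>" by auto
  then show ?case
  proof cases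
    case 1
    with Seq.prems obtain u where "(w, u) \<in> rels S R T \<eta>" "(u, v) \<in> rel S R T \<beta>"
      by (auto simp: rels_append)
    then show ?thesis using Seq.IH(1)[OF 1(2) Seq.prems(2)] by auto
  next
    case 2
    then have "(w, w) \<in> rel S R T \<alpha>" "(w, v) \<in> rel S R T \<beta>"
      using Seq.IH(1)[OF 2(2), of w] Seq.IH(2)[OF 2(3), of v] Seq.prems by auto
    then show ?thesis by auto
  qed
next
  case (Star \<alpha>)
  from Star.prems(1) consider "\<delta> = []" | \<eta> where "\<delta> = \<eta> @ [Star \<alpha>]" "(Y, \<eta>) \<in> H \<alpha>" by auto
  then show ?case
  proof cases
    case 1
    then show ?thesis using Star.prems \<open>w \<in> S\<close> by auto
  next
    case 2
    with Star.prems obtain u where "(w, u) \<in> rels S R T \<eta>" "(u, v) \<in> rel S R T (Star \<alpha>)"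
      by (auto simp: rels_append)
    moreover then have "(w, u) \<in> rel S R T \<alpha>" using Star.IH[OF 2(2) Star.prems(2)] by blast
    ultimately show ?thesis using \<open>w \<in> S\<close> by (auto intro: converse_rtrancl_into_rtrancl)
  qed
qed (use \<open>w \<in> S\<close> in auto)

lemma P_sound:
  assumes RS: "\<forall>a. R a \<subseteq> S \<times> S" and "w \<in> S" "\<forall>\<tau>\<in>l. T \<tau> w"
    and "\<delta> \<in> P l \<alpha>" "(w, v) \<in> rels S R T \<delta>"
  shows "(w, v) \<in> rel S R T \<alpha>"
proof -
  obtain Y where "Y \<subseteq> l" "(Y, \<delta>) \<in> H \<alpha>" using P_imp_H[OF assms(4)] by blast
  then show ?thesis using H_sound[OF RS] assms by (meson subsetD)
qed

section \<open>Unloading\<close>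

primrec unl_box :: "('p, 'a) lbox \<Rightarrow> ('p, 'a) fm" where
  "unl_box (Plain \<phi>) = \<phi>"
| "unl_box (LBox \<alpha> \<xi>) = Box \<alpha> (unl_box \<xi>)"

primrec unl :: "('p, 'a) sfm \<Rightarrow> ('p, 'a) fm" where
  "unl (Free \<phi>) = \<phi>"
| "unl (Loaded \<alpha> \<xi>) = Neg (Box \<alpha> (unl_box \<xi>))"

primrec progs :: "('p, 'a) lbox \<Rightarrow> ('p, 'a) prog list" where
  "progs (Plain \<phi>) = []"
| "progs (LBox \<alpha> \<xi>) = \<alpha> # progs \<xi>"

primrec core :: "('p, 'a) lbox \<Rightarrow> ('p, 'a) fm" where
  "core (Plain \<phi>) = \<phi>"
| "core (LBox \<alpha> \<xi>) = core \<xi>"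

lemma unl_box_lboxes [simp]: "unl_box (lboxes \<delta> \<xi>) = boxes \<delta> (unl_box \<xi>)"
  by (induction \<delta>) auto

lemma progs_lboxes [simp]: "progs (lboxes \<delta> \<xi>) = \<delta> @ progs \<xi>"
  by (induction \<delta>) auto

lemma core_lboxes [simp]: "core (lboxes \<delta> \<xi>) = core \<xi>"
  by (induction \<delta>) auto

lemma lboxes_progs_core: "lboxes (progs \<xi>) (Plain (core \<xi>)) = \<xi>"
  by (induction \<xi>) auto

lemma unl_box_eq: "unl_box \<xi> = boxes (progs \<xi>) (core \<xi>)"
  by (induction \<xi>) auto

lemma unl_lneg [simp]: "unl (lneg \<xi>) = Neg (unl_box \<xi>)"
  by (cases \<xi>) auto

text \<open>A marking is determined by how many leading boxes are marked. Over a finite set of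
  formulas this leaves finitely many sequents.\<close>

lemma finite_unl_box_vimage: "finite {\<xi>. unl_box \<xi> = \<phi>}"
proof (induction \<phi> rule: measure_induct_rule[of size])
  case (less \<phi>)
  show ?case
  proof (cases "\<exists>\<alpha> \<psi>. \<phi> = Box \<alpha> \<psi>")
    case True
    then obtain \<alpha> \<psi> where \<phi>: "\<phi> = Box \<alpha> \<psi>" by blast
    have "{\<xi>. unl_box \<xi> = \<phi>} \<subseteq> insert (Plain \<phi>) (LBox \<alpha> ` {\<xi>. unl_box \<xi> = \<psi>})"
    proof
      fix \<xi> assume "\<xi> \<in> {\<xi>. unl_box \<xi> = \<phi>}"
      then show "\<xi> \<in> insert (Plain \<phi>) (LBox \<alpha> ` {\<xi>. unl_box \<xi> = \<psi>})" by (cases \<xi>) (auto simp: \<phi>)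
    qed
    then show ?thesis using less[of \<psi>] \<phi> by (simp add: finite_subset)
  next
    case False
    have "{\<xi>. unl_box \<xi> = \<phi>} \<subseteq> {Plain \<phi>}"
    proof
      fix \<xi> assume "\<xi> \<in> {\<xi>. unl_box \<xi> = \<phi>}"
      then show "\<xi> \<in> {Plain \<phi>}" using False by (cases \<xi>) auto
    qed
    then show ?thesis by (simp add: finite_subset)
  qed
qed

lemma finite_unl_vimage:
  fixes C :: "('b, 'c) fm set"
  assumes "finite C"
  shows "finite (unl -` C)"
proof -
  have "finite {f. unl f = \<phi>}" for \<phi> :: "('b, 'c) fm"
  proof (cases "\<exists>\<alpha> \<psi>. \<phi> = Neg (Box \<alpha> \<psi>)")
    case True
    then obtain \<alpha> \<psi> where \<phi>: "\<phi> = Neg (Box \<alpha> \<psi>)" by blast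
    have "f \<in> insert (Free \<phi>) (Loaded \<alpha> ` {\<xi>. unl_box \<xi> = \<psi>})" if "unl f = \<phi>" for f
      using that by (cases f) (auto simp: \<phi>)
    then have "{f. unl f = \<phi>} \<subseteq> insert (Free \<phi>) (Loaded \<alpha> ` {\<xi>. unl_box \<xi> = \<psi>})" by blast
    then show ?thesis using finite_unl_box_vimage[of \<psi>] by (simp add: finite_subset)
  next
    case False
    have "f \<in> {Free \<phi>}" if "unl f = \<phi>" for f
      using that False by (cases f) auto
    then have "{f. unl f = \<phi>} \<subseteq> {Free \<phi>}" by blast
    then show ?thesis by (simp add: finite_subset)
  qed
  moreover have "unl -` C = (\<Union>\<phi>\<in>C. {f. unl f = \<phi>})" by auto
  ultimately show ?thesis using assms by (metis (no_types, lifting) finite_UN_I)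
qed

lemma loaded_Un [simp]: "loaded (\<Delta> \<union> \<Gamma>) \<longleftrightarrow> loaded \<Delta> \<or> loaded \<Gamma>"
  by (auto simp: loaded_def)

lemma loaded_insert [simp]:
  "loaded (insert f \<Gamma>) \<longleftrightarrow> (\<exists>\<alpha> \<xi>. f = Loaded \<alpha> \<xi>) \<or> loaded \<Gamma>"
  by (auto simp: loaded_def)

lemma not_loaded_simps [simp]: "\<not> loaded {}" "\<not> loaded (Free ` Y)" "\<not> loaded (proj a \<Delta>)"
  by (auto simp: loaded_def proj_def)

lemma not_loaded_basic: "basic \<Delta> \<Longrightarrow> \<not> loaded \<Delta>"
  by (force simp: loaded_def basic_def)

section \<open>Fischer--Ladner closure\<close>

text \<open>\<open>fl_box\<close> leaves out the closure of its second argument, which grows during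
  the recursion; the recursion can thus follow the program, and \<open>fl\<close> adds the missing
  closure once.\<close>

fun fl :: "('p, 'a) fm \<Rightarrow> ('p, 'a) fm set"
  and fl_box :: "('p, 'a) prog \<Rightarrow> ('p, 'a) fm \<Rightarrow> ('p, 'a) fm set" where
  "fl Bot = {Bot}"
| "fl (Var p) = {Var p}"
| "fl (Neg \<phi>) = insert (Neg \<phi>) (fl \<phi>)"
| "fl (Con \<phi> \<psi>) = insert (Con \<phi> \<psi>) (fl \<phi> \<union> fl \<psi>)"
| "fl (Box \<alpha> \<phi>) = fl_box \<alpha> \<phi> \<union> fl \<phi>"
| "fl_box (Atom a) \<psi> = {Box (Atom a) \<psi>}"
| "fl_box (Test \<tau>) \<psi> = insert (Box (Test \<tau>) \<psi>) (fl \<tau>)"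
| "fl_box (Choice \<alpha> \<beta>) \<psi> = insert (Box (Choice \<alpha> \<beta>) \<psi>) (fl_box \<alpha> \<psi> \<union> fl_box \<beta> \<psi>)"
| "fl_box (Seq \<alpha> \<beta>) \<psi> = insert (Box (Seq \<alpha> \<beta>) \<psi>) (fl_box \<alpha> (Box \<beta> \<psi>) \<union> fl_box \<beta> \<psi>)"
| "fl_box (Star \<alpha>) \<psi> = insert (Box (Star \<alpha>) \<psi>) (fl_box \<alpha> (Box (Star \<alpha>) \<psi>))"

text \<open>A single step of the closure. Unfolding with \<open>H\<close> amounts to several such
  steps, so closure under \<open>fl_succ\<close> is the simpler property to prove by
  induction.\<close>

fun fl_succ :: "('p, 'a) fm \<Rightarrow> ('p, 'a) fm set" where
  "fl_succ (Neg \<phi>) = {\<phi>}"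
| "fl_succ (Con \<phi> \<psi>) = {\<phi>, \<psi>}"
| "fl_succ (Box (Atom a) \<psi>) = {\<psi>}"
| "fl_succ (Box (Test \<tau>) \<psi>) = {\<tau>, \<psi>}"
| "fl_succ (Box (Choice \<alpha> \<beta>) \<psi>) = {Box \<alpha> \<psi>, Box \<beta> \<psi>, \<psi>}"
| "fl_succ (Box (Seq \<alpha> \<beta>) \<psi>) = {Box \<alpha> (Box \<beta> \<psi>), Box \<beta> \<psi>, \<psi>}"
| "fl_succ (Box (Star \<alpha>) \<psi>) = {Box \<alpha> (Box (Star \<alpha>) \<psi>), \<psi>}"
| "fl_succ _ = {}"

lemma fl_box_self: "Box \<alpha> \<psi> \<in> fl_box \<alpha> \<psi>"
  by (cases \<alpha>) auto

lemma fl_self: "\<phi> \<in> fl \<phi>"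
  by (cases \<phi>) (auto simp: fl_box_self)

lemma finite_fl: "finite (fl \<phi>)" and finite_fl_box: "finite (fl_box \<alpha> \<psi>)"
  for \<phi> \<psi> :: "('p, 'a) fm"
  by (induction \<phi> and \<alpha> \<psi> rule: fl_fl_box.induct) auto

lemma fl_closed: "\<chi> \<in> fl \<phi> \<Longrightarrow> fl_succ \<chi> \<subseteq> fl \<phi>"
  and fl_box_closed: "\<chi> \<in> fl_box \<alpha> \<psi> \<Longrightarrow> fl_succ \<chi> \<subseteq> insert \<psi> (fl_box \<alpha> \<psi>)"
  for \<phi> \<psi> :: "('p, 'a) fm"
proof (induction \<phi> and \<alpha> arbitrary: \<chi> and \<chi> \<psi> rule: fm.induct prog.induct)
  case (Neg \<phi>)
  then show ?case using fl_self[of \<phi>] by fastforce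
next
  case (Con \<phi> \<psi>)
  then show ?case using fl_self[of \<phi>] fl_self[of \<psi>] by fastforce
next
  case (Box \<alpha> \<phi>)
  then show ?case using fl_self[of \<phi>] by fastforce
next
  case (Test \<tau>)
  then show ?case using fl_self[of \<tau>] by fastforce
next
  case (Choice \<alpha> \<beta>)
  then show ?case using fl_box_self[of \<alpha> \<psi>] fl_box_self[of \<beta> \<psi>] by fastforce
next
  case (Seq \<alpha> \<beta>)
  then show ?case using fl_box_self[of \<alpha> "Box \<beta> \<psi>"] fl_box_self[of \<beta> \<psi>] by fastforce
next
  case (Star \<alpha>)
  then show ?case using fl_box_self[of \<alpha> "Box (Star \<alpha>) \<psi>"] by fastforce
qed auto

text \<open>The induction needs \<open>\<psi>\<close> arbitrary: the body of a sequence or an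
  iteration is unfolded in front of a further box, and the program that \<open>H\<close> appends is
  absorbed into \<open>\<psi>\<close>.\<close>

lemma fl_succ_closed_box:
  assumes K: "\<And>\<chi>. \<chi> \<in> K \<Longrightarrow> fl_succ \<chi> \<subseteq> K" and "Box \<alpha> \<psi> \<in> K"
  shows "\<psi> \<in> K" "tests \<alpha> \<subseteq> K" "(Y, \<delta>) \<in> H \<alpha> \<Longrightarrow> boxes \<delta> \<psi> \<in> K"
proof -
  have tail: "\<psi> \<in> K" if "Box \<alpha> \<psi> \<in> K" for \<alpha> \<psi>
    using K[OF that] by (cases \<alpha>) auto
  show "\<psi> \<in> K" using tail assms(2) by blast
  show "tests \<alpha> \<subseteq> K"
    using assms(2)
  proof (induction \<alpha> arbitrary: \<psi> rule: prog_induct)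
    case (Test \<tau>)
    then show ?case using K[OF Test] by simp
  next
    case (Choice \<alpha> \<beta>)
    then show ?case using K[OF Choice.prems] Choice.IH[of \<psi>] by simp
  next
    case (Seq \<alpha> \<beta>)
    then show ?case using K[OF Seq.prems] Seq.IH(1)[of "Box \<beta> \<psi>"] Seq.IH(2)[of \<psi>] by simp
  next
    case (Star \<alpha>)
    then show ?case using K[OF Star.prems] Star.IH[of "Box (Star \<alpha>) \<psi>"] by simp
  qed simp
  show "boxes \<delta> \<psi> \<in> K" if "(Y, \<delta>) \<in> H \<alpha>"
    using assms(2) that
  proof (induction \<alpha> arbitrary: Y \<delta> \<psi> rule: prog_induct)
    case (Test \<tau>)
    then show ?case using tail[OF Test(1)] by simp
  next
    case (Choice \<alpha> \<beta>)
    then show ?case using K[OF Choice.prems(1)] Choice.IH[of \<psi> Y \<delta>] by auto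
  next
    case (Seq \<alpha> \<beta>)
    then show ?case
      using K[OF Seq.prems(1)] Seq.IH(1)[of "Box \<beta> \<psi>"] Seq.IH(2)[of \<psi>] by auto
  next
    case (Star \<alpha>)
    then show ?case
      using K[OF Star.prems(1)] Star.IH[of "Box (Star \<alpha>) \<psi>"] by auto
  qed simp
qed

text \<open>The lists for boxes also range over \<open>H\<close> rather than \<open>P\<close>, which
  covers every choice of \<open>l\<close> by \<open>P_imp_H\<close>.\<close>

definition rule_closed :: "('p, 'a) fm set \<Rightarrow> bool" where
  "rule_closed C \<longleftrightarrow>
     (\<forall>\<phi>. Neg (Neg \<phi>) \<in> C \<longrightarrow> \<phi> \<in> C) \<and>
     (\<forall>\<phi> \<psi>. Con \<phi> \<psi> \<in> C \<longrightarrow> \<phi> \<in> C \<and> \<psi> \<in> C) \<and>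
     (\<forall>\<phi> \<psi>. Neg (Con \<phi> \<psi>) \<in> C \<longrightarrow> Neg \<phi> \<in> C \<and> Neg \<psi> \<in> C) \<and>
     (\<forall>\<alpha> \<psi>. Box \<alpha> \<psi> \<in> C \<longrightarrow>
        \<psi> \<in> C \<and> Neg ` tests \<alpha> \<subseteq> C \<and> (\<forall>(Y, \<delta>)\<in>H \<alpha>. boxes \<delta> \<psi> \<in> C)) \<and>
     (\<forall>\<alpha> \<psi>. Neg (Box \<alpha> \<psi>) \<in> C \<longrightarrow>
        Neg \<psi> \<in> C \<and> (\<forall>(Y, \<delta>)\<in>H \<alpha>. Y \<subseteq> C \<and> Neg (boxes \<delta> \<psi>) \<in> C))"

lemma rule_closedD:
  assumes "rule_closed C"
  shows "Neg (Neg \<phi>) \<in> C \<Longrightarrow> \<phi> \<in> C"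
    and "Con \<phi> \<psi> \<in> C \<Longrightarrow> {\<phi>, \<psi>} \<subseteq> C"
    and "Neg (Con \<phi> \<psi>) \<in> C \<Longrightarrow> {Neg \<phi>, Neg \<psi>} \<subseteq> C"
    and "Box \<alpha> \<psi> \<in> C \<Longrightarrow> \<psi> \<in> C"
    and "Box \<alpha> \<psi> \<in> C \<Longrightarrow> \<tau> \<in> tests \<alpha> \<Longrightarrow> Neg \<tau> \<in> C"
    and "Box \<alpha> \<psi> \<in> C \<Longrightarrow> (Y, \<delta>) \<in> H \<alpha> \<Longrightarrow> boxes \<delta> \<psi> \<in> C"
    and "Neg (Box \<alpha> \<psi>) \<in> C \<Longrightarrow> Neg \<psi> \<in> C"
    and "Neg (Box \<alpha> \<psi>) \<in> C \<Longrightarrow> (Y, \<delta>) \<in> H \<alpha> \<Longrightarrow> Y \<subseteq> C"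
    and "Neg (Box \<alpha> \<psi>) \<in> C \<Longrightarrow> (Y, \<delta>) \<in> H \<alpha> \<Longrightarrow> Neg (boxes \<delta> \<psi>) \<in> C"
  using assms unfolding rule_closed_def by blast+

lemma rule_closed_superset:
  assumes "finite \<Phi>"
  shows "\<exists>C. finite C \<and> \<Phi> \<subseteq> C \<and> rule_closed C"
proof -
  define K where "K = (\<Union>\<phi>\<in>\<Phi>. fl \<phi>)"
  have K: "fl_succ \<chi> \<subseteq> K" if "\<chi> \<in> K" for \<chi>
    using fl_closed that unfolding K_def by blast
  \<comment> \<open>One layer of added negations suffices: removing \<open>Neg\<close> leads back
    into \<open>K\<close>, whether the negation was added or was already in
    \<open>K\<close>.\<close>
  have N: "\<chi> \<in> K" if "Neg \<chi> \<in> K \<union> Neg ` K" for \<chi>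
    using that K by fastforce
  have B: "\<psi> \<in> K \<and> tests \<alpha> \<subseteq> K \<and> (\<forall>(Y, \<delta>)\<in>H \<alpha>. boxes \<delta> \<psi> \<in> K)" if "Box \<alpha> \<psi> \<in> K" for \<alpha> \<psi>
    using fl_succ_closed_box[of K, OF K that] by blast
  have C: "\<phi> \<in> K \<and> \<psi> \<in> K" if "Con \<phi> \<psi> \<in> K" for \<phi> \<psi>
    using K[OF that] by simp
  have "rule_closed (K \<union> Neg ` K)"
    unfolding rule_closed_def
  proof (intro conjI allI impI)
    fix \<phi> assume "Neg (Neg \<phi>) \<in> K \<union> Neg ` K"
    then show "\<phi> \<in> K \<union> Neg ` K" using N[of "Neg \<phi>"] N[of \<phi>] by blast
  next
    fix \<alpha> \<psi> assume "Neg (Box \<alpha> \<psi>) \<in> K \<union> Neg ` K"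
    then have "Box \<alpha> \<psi> \<in> K" by (rule N)
    then show "Neg \<psi> \<in> K \<union> Neg ` K" 
      "\<forall>(Y, \<delta>)\<in>H \<alpha>. Y \<subseteq> K \<union> Neg ` K \<and> Neg (boxes \<delta> \<psi>) \<in> K \<union> Neg ` K"
      using B[of \<alpha> \<psi>] H_tests[of _ _ \<alpha>] by fastforce+
  next
    fix \<phi> \<psi> assume "Neg (Con \<phi> \<psi>) \<in> K \<union> Neg ` K"
    then have "Con \<phi> \<psi> \<in> K" by (rule N)
    then show "Neg \<phi> \<in> K \<union> Neg ` K" "Neg \<psi> \<in> K \<union> Neg ` K" using C[of \<phi> \<psi>] by blast+
  next
    fix \<alpha> \<psi> assume "Box \<alpha> \<psi> \<in> K \<union> Neg ` K"
    then have "Box \<alpha> \<psi> \<in> K" by auto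
    then show "\<psi> \<in> K \<union> Neg ` K" "Neg ` tests \<alpha> \<subseteq> K \<union> Neg ` K"
      "\<forall>(Y, \<delta>)\<in>H \<alpha>. boxes \<delta> \<psi> \<in> K \<union> Neg ` K"
      using B[of \<alpha> \<psi>] by blast+
  next
    fix \<phi> \<psi> assume "Con \<phi> \<psi> \<in> K \<union> Neg ` K"
    then have "Con \<phi> \<psi> \<in> K" by auto
    then show "\<phi> \<in> K \<union> Neg ` K" "\<psi> \<in> K \<union> Neg ` K" using C[of \<phi> \<psi>] by blast+
  qed
  moreover have "finite (K \<union> Neg ` K)" using assms by (simp add: K_def finite_fl)
  moreover have "\<Phi> \<subseteq> K \<union> Neg ` K" using fl_self unfolding K_def by blast
  ultimately show ?thesis by blast
qed

section \<open>Closure and finiteness of rule instances\<close>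

lemma in_X_iff: "\<chi> \<in> X l \<alpha> \<psi> \<longleftrightarrow> (\<exists>\<tau>. \<chi> = Neg \<tau> \<and> \<tau> \<in> tests \<alpha> \<and> \<tau> \<notin> l) \<or> (\<exists>\<delta>\<in>P l \<alpha>. \<chi> = boxes \<delta> \<psi>)"
  by (auto simp: X_def F_def)

lemma rule_inst_closure:
  assumes "rule_inst r \<Gamma> G" "\<Gamma>' \<in> G" and C: "rule_closed C" and "unl ` \<Gamma> \<subseteq> C"
  shows "unl ` \<Gamma>' \<subseteq> C"
  using assms(1)
proof cases
  case (neg \<phi> \<Delta>)
  then show ?thesis using assms(2,4) rule_closedD(1)[OF C, of \<phi>] by auto
next
  case (con \<phi> \<psi> \<Delta>)
  then show ?thesis using assms(2,4) rule_closedD(2)[OF C, of \<phi> \<psi>] by auto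
next
  case (neg_con \<phi> \<psi> \<Delta>)
  then show ?thesis using assms(2,4) rule_closedD(3)[OF C, of \<phi> \<psi>] by auto
next
  case (box \<alpha> \<phi> \<Delta>)
  then obtain l where \<Gamma>': "\<Gamma>' = \<Delta> \<union> Free ` X l \<alpha> \<phi>" using assms(2) by (auto simp: unfold_box_def)
  have b: "Box \<alpha> \<phi> \<in> C" using box assms(4) by auto
  have "X l \<alpha> \<phi> \<subseteq> C"
    using P_imp_H[of _ l \<alpha>] rule_closedD(5,6)[OF C b] unfolding in_X_iff subset_iff by metis
  then show ?thesis using assms(4) box \<Gamma>' by auto
next
  case (dia \<alpha> \<phi> \<Delta>)
  then obtain Y \<delta> where \<Gamma>': "\<Gamma>' = \<Delta> \<union> Free ` (Y \<union> {Neg (boxes \<delta> \<phi>)})" "(Y, \<delta>) \<in> H \<alpha>"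
    using assms(2) by (auto simp: unfold_dia_def)
  have "Neg (Box \<alpha> \<phi>) \<in> C" using dia assms(4) by auto
  then have "Y \<subseteq> C" "Neg (boxes \<delta> \<phi>) \<in> C" using rule_closedD(8,9)[OF C _ \<Gamma>'(2)] by blast+
  then show ?thesis using assms(4) dia \<Gamma>' by auto
next
  case (ldia \<alpha> \<xi> \<Delta>)
  then obtain Y \<delta> where \<Gamma>': "\<Gamma>' = \<Delta> \<union> Free ` Y \<union> {lneg (lboxes \<delta> \<xi>)}" "(Y, \<delta>) \<in> H \<alpha>"
    using assms(2) by (auto simp: unfold_ldia_def)
  have "Neg (Box \<alpha> (unl_box \<xi>)) \<in> C" using ldia assms(4) by auto
  then have "Y \<subseteq> C" "Neg (boxes \<delta> (unl_box \<xi>)) \<in> C"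
    using rule_closedD(8,9)[OF C _ \<Gamma>'(2)] by blast+
  then show ?thesis using assms(4) ldia \<Gamma>' by auto
next
  case (modal a \<xi> \<Delta>)
  then have "Neg (unl_box \<xi>) \<in> C"
    using assms(4) rule_closedD(7)[OF C, of "Atom a" "unl_box \<xi>"] by simp
  moreover have "\<phi> \<in> C" if "Free (Box (Atom a) \<phi>) \<in> \<Delta>" for \<phi>
    using rule_closedD(4)[OF C, of "Atom a" \<phi>] assms(4) that modal by force
  ultimately show ?thesis using modal assms(2) by (auto simp: proj_def)
qed (use assms(2,4) in auto)

lemma finite_X: "finite (X l \<alpha> \<psi>)"
  using finite_tests[of \<alpha>] finite_P[of l \<alpha>] by (auto simp: X_def F_def)

lemma rule_inst_finite:
  assumes "rule_inst r \<Gamma> G" "finite \<Gamma>"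
  shows "finite G" "\<And>\<Gamma>'. \<Gamma>' \<in> G \<Longrightarrow> finite \<Gamma>'"
proof -
  have "finite G \<and> (\<forall>\<Gamma>'\<in>G. finite \<Gamma>')"
    using assms(1)
  proof cases
    case (box \<alpha> \<phi> \<Delta>)
    have "G \<subseteq> (\<lambda>l. \<Delta> \<union> Free ` X l \<alpha> \<phi>) ` Pow (tests \<alpha>)" using box by (auto simp: unfold_box_def)
    then have "finite G"
      using finite_tests[of \<alpha>] by (meson finite_Pow_iff finite_imageI finite_subset)
    then show ?thesis using box assms(2) finite_X by (auto simp: unfold_box_def)
  next
    case (dia \<alpha> \<phi> \<Delta>)
    have "G \<subseteq> (\<lambda>(Y, \<delta>). \<Delta> \<union> Free ` (Y \<union> {Neg (boxes \<delta> \<phi>)})) ` H \<alpha>"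
      using dia by (force simp: unfold_dia_def)
    then have "finite G" using finite_H[of \<alpha>] by (meson finite_imageI finite_subset)
    moreover have "finite Y" if "(Y, \<delta>) \<in> H \<alpha>" for Y \<delta>
      using H_tests[OF that] finite_tests finite_subset by blast
    ultimately show ?thesis using dia assms(2) by (auto simp: unfold_dia_def)
  next
    case (ldia \<alpha> \<xi> \<Delta>)
    have "G \<subseteq> (\<lambda>(Y, \<delta>). \<Delta> \<union> (Free ` Y \<union> {lneg (lboxes \<delta> \<xi>)})) ` H \<alpha>"
      using ldia by (force simp: unfold_ldia_def)
    then have "finite G" using finite_H[of \<alpha>] by (meson finite_imageI finite_subset)
    moreover have "finite Y" if "(Y, \<delta>) \<in> H \<alpha>" for Y \<delta>
      using H_tests[OF that] finite_tests finite_subset by blast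
    ultimately show ?thesis using ldia assms(2) by (auto simp: unfold_ldia_def)
  next
    case (modal a \<xi> \<Delta>)
    have "proj a \<Delta> \<subseteq> (\<lambda>f. case unl f of Box \<alpha> \<phi> \<Rightarrow> Free \<phi> | _ \<Rightarrow> f) ` \<Delta>"
      by (force simp: proj_def image_iff)
    then have "finite (proj a \<Delta>)" using modal assms(2) by (simp add: finite_surj)
    then show ?thesis using modal by auto
  qed (use assms(2) in auto)
  then show "finite G" "\<And>\<Gamma>'. \<Gamma>' \<in> G \<Longrightarrow> finite \<Gamma>'" by auto
qed

lemma rule_inst_nonempty: "rule_inst r \<Gamma> G \<Longrightarrow> G \<noteq> {}"
proof (induction rule: rule_inst.induct)
  case (dia \<alpha> \<phi> \<Delta>)
  then show ?case using H_nonempty[of \<alpha>] by (force simp: unfold_dia_def)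
next
  case (ldia \<alpha> \<xi> \<Delta>)
  then show ?case using H_nonempty[of \<alpha>] by (force simp: unfold_ldia_def)
qed (auto simp: unfold_box_def)

section \<open>Termination of the local rules\<close>

text \<open>Boxes of atomic programs weigh nothing, as the unfolding rules leave them alone. The
  summand 2 pays for the negation of a test in a box unfolding. An iteration needs no surcharge,
  because it reappears only behind an atomic program.\<close>

primrec wt :: "('p, 'a) fm \<Rightarrow> nat" and pwt :: "('p, 'a) prog \<Rightarrow> nat" where
  "wt Bot = 0"
| "wt (Var p) = 0"
| "wt (Neg \<phi>) = Suc (wt \<phi>)"
| "wt (Con \<phi> \<psi>) = 2 + wt \<phi> + wt \<psi>"
| "wt (Box \<alpha> \<phi>) = (if atomic \<alpha> then 0 else 2 + pwt \<alpha> + wt \<phi>)"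
| "pwt (Atom a) = 0"
| "pwt (Test \<tau>) = wt \<tau>"
| "pwt (Choice \<alpha> \<beta>) = pwt \<alpha> + pwt \<beta>"
| "pwt (Seq \<alpha> \<beta>) = pwt \<alpha> + pwt \<beta>"
| "pwt (Star \<alpha>) = pwt \<alpha>"

lemma wt_tests: "\<tau> \<in> tests \<alpha> \<Longrightarrow> wt \<tau> \<le> pwt \<alpha>"
  by (induction \<alpha> rule: prog_induct) auto

lemma wt_unfold:
  assumes "\<not> atomic \<alpha>"
  shows "\<chi> \<in> X l \<alpha> \<psi> \<Longrightarrow> wt \<chi> < wt (Box \<alpha> \<psi>)"
    and "(Y, \<delta>) \<in> H \<alpha> \<Longrightarrow> \<chi> \<in> Y \<Longrightarrow> wt \<chi> < wt (Neg (Box \<alpha> \<psi>))"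
    and "(Y, \<delta>) \<in> H \<alpha> \<Longrightarrow> wt (Neg (boxes \<delta> \<psi>)) < wt (Neg (Box \<alpha> \<psi>))"
proof -
  have bx: "wt (boxes \<delta> \<psi>) \<le> wt \<psi>" if "(Y, \<delta>) \<in> H \<alpha>" for Y \<delta>
    using H_head[OF that] by (auto simp: atomic_def)
  show "wt \<chi> < wt (Box \<alpha> \<psi>)" if "\<chi> \<in> X l \<alpha> \<psi>"
    using that assms wt_tests[of _ \<alpha>] bx P_imp_H[of _ l \<alpha>] by (fastforce simp: in_X_iff)
  show "wt \<chi> < wt (Neg (Box \<alpha> \<psi>))" if "(Y, \<delta>) \<in> H \<alpha>" "\<chi> \<in> Y"
    using wt_tests[of \<chi> \<alpha>] H_tests[OF that(1)] that assms by auto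
  show "wt (Neg (boxes \<delta> \<psi>)) < wt (Neg (Box \<alpha> \<psi>))" if "(Y, \<delta>) \<in> H \<alpha>"
    using bx[OF that] assms by auto
qed

definition weights :: "('p, 'a) sequent \<Rightarrow> nat multiset" where
  "weights \<Gamma> = image_mset (\<lambda>f. wt (unl f)) (mset_set \<Gamma>)"

lemma weights_replace:
  assumes "finite \<Delta>" "finite G" "f \<notin> \<Delta>" "\<And>g. g \<in> G \<Longrightarrow> wt (unl g) < wt (unl f)"
  shows "(weights (\<Delta> \<union> G), weights (\<Delta> \<union> {f})) \<in> mult less_than"
proof -
  \<comment> \<open>Sequents are sets, so members of \<open>G\<close> that already occur in the
    context must not be counted twice.\<close>
  have "weights (\<Delta> \<union> G) = weights \<Delta> + weights (G - \<Delta>)"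
  proof -
    have "mset_set (\<Delta> \<union> G) = mset_set \<Delta> + mset_set (G - \<Delta>)"
      using assms(1,2) by (subst mset_set_Union[symmetric]) auto
    then show ?thesis by (simp add: weights_def)
  qed
  moreover have "weights (\<Delta> \<union> {f}) = weights \<Delta> + {#wt (unl f)#}"
    using assms(1,3) by (simp add: weights_def)
  moreover have "(weights \<Delta> + weights (G - \<Delta>), weights \<Delta> + {#wt (unl f)#}) \<in> mult less_than"
    by (rule one_step_implies_mult) (use assms in \<open>auto simp: weights_def\<close>)
  ultimately show ?thesis by simp
qed

text \<open>(L+) and (L-) are excluded because they only change marks, which the weights do not see;
  (M) is excluded because it uncovers formulas of arbitrary weight.\<close>

lemma local_rule_decreases:
  assumes "rule_inst r \<Gamma> G" "r \<notin> {RLPlus, RLMinus, RM}" "finite \<Gamma>" "\<Gamma>' \<in> G"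
  shows "(weights \<Gamma>', weights \<Gamma>) \<in> mult less_than"
  using assms(1)
proof cases
  case (box \<alpha> \<phi> \<Delta>)
  then obtain l where "\<Gamma>' = \<Delta> \<union> Free ` X l \<alpha> \<phi>" using assms(4) by (auto simp: unfold_box_def)
  then show ?thesis using box assms(3) wt_unfold(1)[OF box(5)] finite_X[of l \<alpha> \<phi>]
    by (auto intro!: weights_replace simp del: wt.simps Un_insert_right)
next
  case (dia \<alpha> \<phi> \<Delta>)
  then obtain Y \<delta> where *: "\<Gamma>' = \<Delta> \<union> Free ` (Y \<union> {Neg (boxes \<delta> \<phi>)})" "(Y, \<delta>) \<in> H \<alpha>"
    using assms(4) by (auto simp: unfold_dia_def)
  then have "finite Y" using H_tests finite_tests finite_subset by metis
  then show ?thesis unfolding *(1) dia(2) using dia(5,4) assms(3) wt_unfold(2,3)[OF dia(5) *(2)]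
    by (intro weights_replace) (auto simp: dia(2) simp del: wt.simps)
next
  case (ldia \<alpha> \<xi> \<Delta>)
  then obtain Y \<delta> where *: "\<Gamma>' = \<Delta> \<union> (Free ` Y \<union> {lneg (lboxes \<delta> \<xi>)})" "(Y, \<delta>) \<in> H \<alpha>"
    using assms(4) by (auto simp: unfold_ldia_def)
  then have "finite Y" using H_tests finite_tests finite_subset by metis
  then show ?thesis unfolding *(1) ldia(2) using ldia(5,4) assms(3) wt_unfold(2,3)[OF ldia(5) *(2)]
    by (intro weights_replace) (auto simp: ldia(2) simp del: wt.simps)
next
  case (neg \<phi> \<Delta>)
  then show ?thesis using assms(3,4) by (auto intro!: weights_replace simp del: Un_insert_right)
next
  case (con \<phi> \<psi> \<Delta>)
  then show ?thesis using assms(3,4) by (auto intro!: weights_replace simp del: Un_insert_right)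
next
  case (neg_con \<phi> \<psi> \<Delta>)
  then show ?thesis using assms(3,4) by (auto intro!: weights_replace simp del: Un_insert_right)
qed (use assms(2) in auto)

section \<open>Soundness\<close>

definition sats :: "('w, 'p, 'a) kripke \<Rightarrow> ('p, 'a) sequent \<Rightarrow> 'w \<Rightarrow> bool" where
  "sats M \<Gamma> w \<longleftrightarrow> (\<forall>f\<in>\<Gamma>. sat M (unl f) w)"

lemma sats_simps [simp]:
  "sats M (\<Delta> \<union> \<Gamma>) w \<longleftrightarrow> sats M \<Delta> w \<and> sats M \<Gamma> w"
  "sats M (insert f \<Gamma>) w \<longleftrightarrow> sat M (unl f) w \<and> sats M \<Gamma> w"
  "sats M (Free ` Y) w \<longleftrightarrow> (\<forall>\<phi>\<in>Y. sat M \<phi> w)"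
  "sats M {} w"
  by (auto simp: sats_def)

text \<open>Preserved by the rules, since (L+) demands a free context. The context of a loaded
  formula is then free, so a witness always belongs to the formula on which a loaded rule
  acts.\<close>

definition one_loaded :: "('p, 'a) sequent \<Rightarrow> bool" where
  "one_loaded \<Gamma> \<longleftrightarrow> (\<forall>\<alpha> \<xi> \<beta> \<zeta>. Loaded \<alpha> \<xi> \<in> \<Gamma> \<and> Loaded \<beta> \<zeta> \<in> \<Gamma> \<longrightarrow> \<alpha> = \<beta> \<and> \<xi> = \<zeta>)"

lemma one_loaded_not_loaded: "\<not> loaded \<Gamma> \<Longrightarrow> one_loaded \<Gamma>"
  by (auto simp: one_loaded_def loaded_def)

lemma one_loaded_replace: "\<not> loaded \<Delta> \<Longrightarrow> one_loaded (\<Delta> \<union> {f})"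
  by (auto simp: one_loaded_def loaded_def)

lemma one_loaded_context: "one_loaded (\<Delta> \<union> {Loaded \<alpha> \<xi>}) \<Longrightarrow> Loaded \<alpha> \<xi> \<notin> \<Delta> \<Longrightarrow> \<not> loaded \<Delta>"
  by (auto simp: one_loaded_def loaded_def)

lemma lneg_lboxes_Loaded: "\<delta> \<noteq> [] \<Longrightarrow> \<exists>\<alpha> \<xi>. lneg (lboxes \<delta> \<zeta>) = Loaded \<alpha> \<xi>"
  by (cases \<delta>) auto

lemma rule_inst_one_loaded:
  assumes "rule_inst r \<Gamma> G" "\<Gamma>' \<in> G" "one_loaded \<Gamma>"
  shows "one_loaded \<Gamma>'"
  using assms(1)
proof cases
  case (ldia \<alpha> \<xi> \<Delta>)
  then have "\<not> loaded \<Delta>" using one_loaded_context assms(3) by blast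
  moreover obtain Y \<delta> where "\<Gamma>' = (\<Delta> \<union> Free ` Y) \<union> {lneg (lboxes \<delta> \<xi>)}"
    using ldia assms(2) by (auto simp: unfold_ldia_def)
  ultimately show ?thesis using one_loaded_replace[of "\<Delta> \<union> Free ` Y"] by simp
next
  case (modal a \<xi> \<Delta>)
  then show ?thesis using assms(2) one_loaded_replace[of "proj a \<Delta>"] by simp
next
  case (lplus a \<delta> \<phi> \<Delta>)
  then show ?thesis using assms(2) one_loaded_replace by blast
next
  case (lminus \<delta> \<phi> \<Delta>)
  then show ?thesis using assms(2) one_loaded_replace not_loaded_basic by blast
qed (use assms(2,3) in \<open>auto simp: one_loaded_def\<close>)

lemma sat_unfold_box:
  assumes M: "kripke_model M" and "w \<in> states M" "sat M (Box \<alpha> \<psi>) w"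
  shows "\<exists>\<Gamma>\<in>unfold_box \<alpha> \<psi>. \<forall>\<chi>\<in>\<Gamma>. sat M \<chi> w"
proof -
  \<comment> \<open>Choosing the tests true at \<open>w\<close> makes every member of
    \<open>F\<close> true, and every list of \<open>P l \<alpha>\<close> becomes a way to run
    \<open>\<alpha>\<close> from \<open>w\<close>.\<close>
  define l where "l = {\<tau> \<in> tests \<alpha>. sat M \<tau> w}"
  have acc: "\<forall>a. acc M a \<subseteq> states M \<times> states M" using M by (simp add: kripke_model_def)
  have "sat M \<chi> w" if "\<chi> \<in> X l \<alpha> \<psi>" for \<chi>
    using that unfolding in_X_iff
  proof (elim disjE exE bexE)
    fix \<delta> assume d: "\<delta> \<in> P l \<alpha>" "\<chi> = boxes \<delta> \<psi>"
    have "(w, v) \<in> prel M \<alpha>" if "(w, v) \<in> prels M \<delta>" for v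
      unfolding prel_eq_rel using P_sound[OF acc assms(2) _ d(1) that] by (simp add: l_def)
    then show "sat M \<chi> w" using assms(3) d(2) by (simp add: sat_boxes)
  qed (auto simp: l_def)
  moreover have "X l \<alpha> \<psi> \<in> unfold_box \<alpha> \<psi>" by (auto simp: unfold_box_def l_def)
  ultimately show ?thesis by blast
qed

lemma prels_H:
  assumes M: "kripke_model M" and "(w, v) \<in> prels M (\<alpha> # \<eta>)"
  shows "\<exists>(Y, \<delta>)\<in>H \<alpha>. (\<forall>\<tau>\<in>Y. sat M \<tau> w) \<and> (w, v) \<in> prels M (\<delta> @ \<eta>)"
proof -
  have acc: "\<forall>a. acc M a \<subseteq> states M \<times> states M" using M by (simp add: kripke_model_def)
  from assms(2) obtain u where u: "(w, u) \<in> rel (states M) (acc M) (sat M) \<alpha>" "(u, v) \<in> prels M \<eta>"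
    by auto
  from H_complete[OF acc u(1)] obtain Y \<delta> where "(Y, \<delta>) \<in> H \<alpha>" "\<forall>\<tau>\<in>Y. sat M \<tau> w"
    "(w, u) \<in> prels M \<delta>" by blast
  moreover then have "(w, v) \<in> prels M (\<delta> @ \<eta>)" using u by (auto simp: rels_append)
  ultimately show ?thesis by blast
qed

lemma sat_unfold_dia:
  assumes M: "kripke_model M" and "sat M (Neg (Box \<alpha> \<psi>)) w"
  shows "\<exists>\<Gamma>\<in>unfold_dia \<alpha> \<psi>. \<forall>\<chi>\<in>\<Gamma>. sat M \<chi> w"
proof -
  from assms(2) obtain v where v: "(w, v) \<in> prels M [\<alpha>]" "\<not> sat M \<psi> v" by (auto simp: prel_eq_rel)
  from prels_H[OF M v(1)] obtain Y \<delta> where Y: "(Y, \<delta>) \<in> H \<alpha>" "\<forall>\<tau>\<in>Y. sat M \<tau> w"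
    "(w, v) \<in> prels M \<delta>" by auto
  then have "sat M (Neg (boxes \<delta> \<psi>)) w" using v(2) by (auto simp: sat_boxes)
  moreover have "Y \<union> {Neg (boxes \<delta> \<psi>)} \<in> unfold_dia \<alpha> \<psi>" using Y(1) by (auto simp: unfold_dia_def)
  ultimately show ?thesis using Y(2) by (intro bexI[of _ "Y \<union> {Neg (boxes \<delta> \<psi>)}"]) auto
qed

lemma rule_inst_sound:
  assumes "rule_inst r \<Gamma> G" "r \<notin> {RLDia, RM}"
    and M: "kripke_model M" and w: "w \<in> states M" "sats M \<Gamma> w"
  shows "\<exists>\<Gamma>'\<in>G. sats M \<Gamma>' w"
  using assms(1)
proof cases
  case (box \<alpha> \<phi> \<Delta>)
  then obtain Y where "Y \<in> unfold_box \<alpha> \<phi>" "\<forall>\<chi>\<in>Y. sat M \<chi> w"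
    using sat_unfold_box[OF M w(1), of \<alpha> \<phi>] w(2) by auto
  then have "sats M (\<Delta> \<union> Free ` Y) w" "\<Delta> \<union> Free ` Y \<in> G" using box w(2) by auto
  then show ?thesis by blast
next
  case (dia \<alpha> \<phi> \<Delta>)
  then obtain Y where "Y \<in> unfold_dia \<alpha> \<phi>" "\<forall>\<chi>\<in>Y. sat M \<chi> w"
    using sat_unfold_dia[OF M, of \<alpha> \<phi> w] w(2) by auto
  then have "sats M (\<Delta> \<union> Free ` Y) w" "\<Delta> \<union> Free ` Y \<in> G" using dia w(2) by auto
  then show ?thesis by blast
qed (use assms(2) w in auto)

text \<open>Of the run only its endpoint \<open>v\<close> is kept, which stays fixed during the
  descent. The run passes through the whole marked block, so one choice of \<open>v\<close> serves
  all later modal steps of that block.\<close>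

definition witness :: "('w, 'p, 'a) kripke \<Rightarrow> ('p, 'a) sequent \<Rightarrow> 'w \<Rightarrow> 'w \<Rightarrow> bool" where
  "witness M \<Gamma> w v \<longleftrightarrow>
     (\<exists>\<alpha> \<xi>. Loaded \<alpha> \<xi> \<in> \<Gamma> \<and> (w, v) \<in> prels M (\<alpha> # progs \<xi>) \<and> \<not> sat M (core \<xi>) v)"

lemma witness_exists:
  assumes "loaded \<Gamma>" "sats M \<Gamma> w"
  shows "\<exists>v. witness M \<Gamma> w v"
proof -
  obtain \<alpha> \<xi> where l: "Loaded \<alpha> \<xi> \<in> \<Gamma>" using assms(1) by (auto simp: loaded_def)
  then have "\<not> sat M (boxes (\<alpha> # progs \<xi>) (core \<xi>)) w"
    using assms(2) by (auto simp: sats_def unl_box_eq)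
  then show ?thesis using l unfolding sat_boxes witness_def by blast
qed

lemma prels_rank_mono:
  assumes "\<forall>a w v. (w, v) \<in> acc M a \<longrightarrow> rank v = Suc (rank w)" "(w, v) \<in> prels M \<delta>"
  shows "rank w \<le> (rank v :: nat)"
proof -
  have r: "rank w \<le> rank v" if "(w, v) \<in> rel (states M) (acc M) (sat M) \<alpha>" for w v \<alpha>
    using that
  proof (induction \<alpha> arbitrary: w v rule: prog_induct)
    case (Atom a)
    then show ?case using assms(1) by fastforce
  next
    case (Seq \<alpha> \<beta>)
    then obtain u where "(w, u) \<in> rel (states M) (acc M) (sat M) \<alpha>"
      "(u, v) \<in> rel (states M) (acc M) (sat M) \<beta>" by auto
    then show ?case using Seq.IH(1)[of w u] Seq.IH(2)[of u v] by simp
  next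
    case (Star \<alpha>)
    then have "(w, v) \<in> (rel (states M) (acc M) (sat M) \<alpha>)\<^sup>*" by simp
    then show ?case
      by (induction rule: rtrancl_induct) (use Star.IH in \<open>auto intro: order_trans\<close>)
  qed auto
  from assms(2) show ?thesis
  proof (induction \<delta> arbitrary: w)
    case (Cons \<alpha> \<delta>)
    then show ?case using r by (fastforce intro: order_trans)
  qed simp
qed

text \<open>(M) follows the run by one atomic step; unfolding a loaded diamond picks the member of
  \<open>H\<close> that the run takes. (L+) cannot act on a loaded sequent, and (L-) leads to a free
  one.\<close>

lemma rule_inst_sound_loaded:
  assumes "rule_inst r \<Gamma> G" "loaded \<Gamma>" "one_loaded \<Gamma>"
    and M: "kripke_model M" and rank: "\<forall>a w v. (w, v) \<in> acc M a \<longrightarrow> rank v = Suc (rank w)"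
    and w: "w \<in> states M" "sats M \<Gamma> w" "witness M \<Gamma> w v"
  shows "\<exists>\<Gamma>'\<in>G. \<exists>w'\<in>states M. sats M \<Gamma>' w' \<and>
    (loaded \<Gamma>' \<longrightarrow> witness M \<Gamma>' w' v \<and>
      (rank v - rank w' < rank v - rank w \<or> w' = w \<and> r \<notin> {RLPlus, RLMinus, RM}))"
proof -
  have free: ?thesis if "r \<in> {RNeg, RCon, RNegCon, RBox, RDia}"
  proof -
    have "r \<notin> {RLDia, RM}" using that by auto
    then obtain \<Gamma>' where \<Gamma>': "\<Gamma>' \<in> G" "sats M \<Gamma>' w"
      using rule_inst_sound[OF assms(1) _ M w(1,2)] by blast
    have "Loaded \<alpha> \<xi> \<in> \<Gamma>'" if "Loaded \<alpha> \<xi> \<in> \<Gamma>" for \<alpha> \<xi>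
      using assms(1) by cases (use that \<open>r \<in> _\<close> \<Gamma>'(1) in auto)
    then have "witness M \<Gamma>' w v" using w(3) unfolding witness_def by blast
    moreover have "r \<notin> {RLPlus, RLMinus, RM}" using that by auto
    ultimately show ?thesis using \<Gamma>' w(1) by blast
  qed
  from assms(1) show ?thesis
  proof cases
    case (ldia \<alpha> \<xi> \<Delta>)
    then have "\<not> loaded \<Delta>" using one_loaded_context assms(3) by blast
    then have "(w, v) \<in> prels M (\<alpha> # progs \<xi>)" and v: "\<not> sat M (core \<xi>) v"
      using w(3) ldia by (auto simp: witness_def loaded_def)
    from prels_H[OF M this(1)] obtain Y \<delta> where Y: "(Y, \<delta>) \<in> H \<alpha>" "\<forall>\<tau>\<in>Y. sat M \<tau> w"
      "(w, v) \<in> prels M (\<delta> @ progs \<xi>)" by auto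
    let ?\<Gamma>' = "\<Delta> \<union> (Free ` Y \<union> {lneg (lboxes \<delta> \<xi>)})"
    have "\<not> sat M (boxes (\<delta> @ progs \<xi>) (core \<xi>)) w" using Y(3) v unfolding sat_boxes by blast
    then have "sats M ?\<Gamma>' w" using Y w(2) ldia by (simp add: unl_box_eq)
    moreover have "?\<Gamma>' \<in> G" using ldia Y(1) by (auto simp: unfold_ldia_def)
    moreover have "witness M ?\<Gamma>' w v" if "loaded ?\<Gamma>'"
    proof -
      have "\<exists>\<beta> \<zeta>. lneg (lboxes \<delta> \<xi>) = Loaded \<beta> \<zeta>" using that \<open>\<not> loaded \<Delta>\<close> by auto
      then obtain \<beta> \<zeta> where b: "lboxes \<delta> \<xi> = LBox \<beta> \<zeta>" by (cases "lboxes \<delta> \<xi>") auto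
      have "\<delta> @ progs \<xi> = \<beta> # progs \<zeta>" "core \<xi> = core \<zeta>"
        using arg_cong[OF b, of progs] arg_cong[OF b, of core] by auto
      then show ?thesis using Y(3) v b unfolding witness_def by fastforce
    qed
    ultimately show ?thesis using w(1) ldia by blast
  next
    case (modal a \<xi> \<Delta>)
    then have "\<not> loaded \<Delta>" using not_loaded_basic by blast
    then obtain u where u: "(w, u) \<in> acc M a" "(u, v) \<in> prels M (progs \<xi>)" and v: "\<not> sat M (core \<xi>) v"
      using w(3) modal by (auto simp: witness_def loaded_def)
    have S: "u \<in> states M" using M u(1) by (auto simp: kripke_model_def)
    \<comment> \<open>The subtraction does not truncate: a run leads from \<open>u\<close> to
      \<open>v\<close>, so the rank of \<open>u\<close> is at most that of \<open>v\<close>.\<close>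
    have r: "rank v - rank u < rank v - rank w"
      using rank[rule_format, OF u(1)] prels_rank_mono[OF rank u(2)] by simp
    have "sats M (proj a \<Delta>) u"
      using w(2) modal u(1) by (fastforce simp: proj_def sats_def)
    moreover have "\<not> sat M (boxes (progs \<xi>) (core \<xi>)) u" using u(2) v unfolding sat_boxes by blast
    ultimately have "sats M (proj a \<Delta> \<union> {lneg \<xi>}) u" by (simp add: unl_box_eq)
    moreover have "witness M (proj a \<Delta> \<union> {lneg \<xi>}) u v" if "loaded (proj a \<Delta> \<union> {lneg \<xi>})"
      using that u(2) v by (cases \<xi>) (auto simp: witness_def)
    ultimately show ?thesis using r S modal by blast
  next
    case (lplus a \<delta> \<phi> \<Delta>)
    then show ?thesis using assms(2) by simp
  next
    case (lminus \<delta> \<phi> \<Delta>)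
    then show ?thesis using w(1,2) not_loaded_basic[of \<Delta>] by auto
  qed (use free in auto)
qed

section \<open>Ancestors, repeats and finiteness of branches\<close>

lemma node_prefix:
  assumes "tableau_for \<Gamma> T" "t \<in> nodes T" "prefix s t"
  shows "s \<in> nodes T"
proof -
  have "s @ xs \<in> nodes T \<Longrightarrow> s \<in> nodes T" for xs
  proof (induction xs rule: rev_induct)
    case (snoc x xs)
    then have "s @ xs \<in> nodes T" using assms(1) unfolding tableau_for_def by (metis append.assoc)
    then show ?case by (rule snoc.IH)
  qed simp
  then show ?thesis using assms(2,3) by (auto simp: prefix_def)
qed

lemma interior_if_extension:
  assumes "tableau_for \<Gamma> T" "t \<in> nodes T" "strict_prefix s t"
  shows "interior T s"
proof -
  obtain x xs where "t = s @ x # xs" using assms(3) by (metis strict_prefixE')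
  then have "prefix (s @ [x]) t" by simp
  then have "s @ [x] \<in> nodes T" "s \<in> nodes T"
    using node_prefix[OF assms(1,2)] assms(3) by (auto simp: strict_prefix_def)
  then show ?thesis by (auto simp: interior_def children_def)
qed

text \<open>The nearest ancestor with the same label lies between \<open>c\<close> and
  \<open>s\<close>, so its path to \<open>s\<close> is part of a path already known to be
  loaded.\<close>

lemma loaded_path_repeatI:
  assumes "s \<in> nodes T" "strict_prefix c s" "lab T c = lab T s"
    and "\<And>d. prefix c d \<Longrightarrow> prefix d s \<Longrightarrow> loaded (lab T d)"
  shows "loaded_path_repeat T s"
proof -
  let ?P = "\<lambda>c'. prefix c c' \<and> strict_prefix c' s \<and> lab T c' = lab T s"
  have "\<exists>c'. ?P c' \<and> (\<forall>d. ?P d \<longrightarrow> length d \<le> length c')"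
    by (rule ex_has_greatest_nat[of ?P c length "length s"])
      (use assms(2,3) in \<open>auto dest: prefix_length_less\<close>)
  then obtain c' where c': "?P c'" "\<And>d. ?P d \<Longrightarrow> length d \<le> length c'" by blast
  have "companion T s c'"
    unfolding companion_def
  proof (intro conjI allI impI)
    fix d assume d: "strict_prefix c' d \<and> strict_prefix d s"
    then have "prefix c d" using c'(1) by (meson prefix_order.order_trans prefix_order.less_imp_le)
    then show "lab T d \<noteq> lab T s" using c'(2)[of d] d prefix_length_less[of c' d] by auto
  qed (use assms(1) c'(1) in auto)
  moreover have "loaded (lab T d)" if "prefix c' d" "prefix d s" for d
    using assms(4) that c'(1) prefix_order.order_trans by blast
  ultimately show ?thesis unfolding loaded_path_repeat_def by blast
qed

lemma tableau_label_invariant: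
  assumes "tableau_for \<Gamma> T" "\<not> loaded \<Gamma>" "unl ` \<Gamma> \<subseteq> C" "rule_closed C" "t \<in> nodes T"
  shows "unl ` lab T t \<subseteq> C \<and> one_loaded (lab T t)"
  using assms(5)
proof (induction t rule: rev_induct)
  case Nil
  then show ?case using assms by (simp add: tableau_for_def one_loaded_not_loaded)
next
  case (snoc i t)
  then have t: "t \<in> nodes T" using assms(1) unfolding tableau_for_def by blast
  have c: "t @ [i] \<in> children T t" using snoc by (simp add: children_def)
  then have r: "rule_inst (applied T t) (lab T t) (lab T ` children T t)"
    using assms(1) t unfolding tableau_for_def interior_def by blast
  show ?case
    using snoc.IH[OF t] rule_inst_closure[OF r imageI[OF c] assms(4)]
      rule_inst_one_loaded[OF r imageI[OF c]] by simp
qed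

lemma pigeonhole_less:
  fixes f :: "nat \<Rightarrow> 'b"
  assumes "infinite N" "f ` N \<subseteq> B" "finite B"
  shows "\<exists>m\<in>N. \<exists>n\<in>N. m < n \<and> f m = f n"
proof -
  have "\<not> inj_on f N" using assms finite_imageD finite_subset by metis
  then show ?thesis unfolding inj_on_def by (metis nat_neq_iff)
qed

text \<open>An infinite branch carries finitely many labels. If it is free infinitely often, some
  free label recurs; otherwise it is loaded from some point on, and a label recurs along a loaded
  path. Either repeat would have to be a leaf.\<close>

lemma pdl_tableau_wf:
  assumes T: "pdl_tableau_for \<Gamma> T" and fin: "finite B" and B: "\<And>t. t \<in> nodes T \<Longrightarrow> lab T t \<in> B"
  shows "wf {(t, s). t \<in> children T s}"
  unfolding wf_iff_no_infinite_down_chain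
proof
  assume "\<exists>b. \<forall>i. (b (Suc i), b i) \<in> {(t, s). t \<in> children T s}"
  then obtain b where b: "\<And>i. b (Suc i) \<in> children T (b i)" by auto
  have tab: "tableau_for \<Gamma> T" using T by (simp add: pdl_tableau_for_def)
  have len: "length (b i) = length (b 0) + i" for i
    by (induction i) (use b in \<open>auto simp: children_def\<close>, metis (mono_tags, lifting) add_Suc_right length_append_singleton)
  have node: "b i \<in> nodes T" for i
  proof -
    have "b (Suc i) \<in> nodes T" "prefix (b i) (b (Suc i))" using b[of i] by (auto simp: children_def)
    then show ?thesis by (rule node_prefix[OF tab])
  qed
  have pre: "prefix (b i) (b j)" if "i \<le> j" for i j
    using that
  proof (induction rule: dec_induct)
    case (step j)
    have "prefix (b j) (b (Suc j))" using b[of j] by (auto simp: children_def)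
    then show ?case using step.IH prefix_order.order_trans by blast
  qed simp
  have spre: "strict_prefix (b i) (b j)" if "i < j" for i j
    using pre[of i j] that len[of i] len[of j] by (auto simp: strict_prefix_def)
  have noleaf: "\<not> leaf T (b i)" for i using b[of i] by (auto simp: leaf_def)
  show False
  proof (cases "infinite {i. \<not> loaded (lab T (b i))}")
    case True
    from pigeonhole_less[OF True, of "\<lambda>i. lab T (b i)" B] obtain m n where
      "\<not> loaded (lab T (b n))" "m < n" "lab T (b m) = lab T (b n)" using fin B node by auto
    then have "free_repeat T (b n)" using node spre unfolding free_repeat_def repeat_def by blast
    then show False using T noleaf unfolding pdl_tableau_for_def by blast
  next
    case False
    then obtain k where k: "\<And>i. k \<le> i \<Longrightarrow> loaded (lab T (b i))"
      by (metis (mono_tags, lifting) finite_nat_set_iff_bounded linorder_not_less mem_Collect_eq)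
    have "infinite {k..}" by (simp add: infinite_Ici)
    from pigeonhole_less[OF this, of "\<lambda>i. lab T (b i)" B] obtain m n where
      mn: "k \<le> m" "m < n" "lab T (b m) = lab T (b n)" using fin B node by auto
    have "loaded_path_repeat T (b n)"
    proof (rule loaded_path_repeatI[OF node spre[OF mn(2)] mn(3)])
      fix d assume d: "prefix (b m) d" "prefix d (b n)"
      define j where "j = length d - length (b 0)"
      have l: "length (b m) \<le> length d" "length d \<le> length (b n)"
        using d prefix_length_le by blast+
      then have j: "m \<le> j" "j \<le> n" "length (b j) = length d" using len[of m] len[of n] len[of j]
        unfolding j_def by linarith+
      have "d = b j"
        using d(2) pre[OF j(2)] j(3) by (metis prefix_length_prefix prefix_order.antisym order_refl)
      then show "loaded (lab T d)" using k mn(1) j(1) by simp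
    qed
    then show False using T noleaf unfolding pdl_tableau_for_def by blast
  qed
qed

lemma extension_trancl_children:
  assumes "tableau_for \<Gamma> T" "t \<in> nodes T" "strict_prefix s t"
  shows "(t, s) \<in> {(t, s). t \<in> children T s}\<^sup>+"
proof -
  have "s @ xs \<in> nodes T \<Longrightarrow> xs \<noteq> [] \<Longrightarrow> (s @ xs, s) \<in> {(t, s). t \<in> children T s}\<^sup>+" for xs
  proof (induction xs rule: rev_induct)
    case (snoc x xs)
    have n: "s @ xs \<in> nodes T" using node_prefix[OF assms(1) snoc.prems(1), of "s @ xs"] by simp
    have c: "(s @ xs @ [x], s @ xs) \<in> {(t, s). t \<in> children T s}"
      using snoc.prems by (simp add: children_def)
    show ?case
    proof (cases "xs = []")
      case True
      then show ?thesis using c by auto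
    next
      case False
      then show ?thesis using c snoc.IH[OF n] by (meson trancl_into_trancl2)
    qed
  qed simp
  then show ?thesis using assms(2,3) by (auto simp: strict_prefix_def prefix_def)
qed

section \<open>The descent in a ranked model\<close>

lemma closed_sequent_unsat: "closed_sequent \<Gamma> \<Longrightarrow> \<not> sats M \<Gamma> w"
proof
  assume c: "closed_sequent \<Gamma>" and "sats M \<Gamma> w"
  then have "sat M \<phi> w" if "Free \<phi> \<in> \<Gamma>" for \<phi> using that unfolding sats_def by force
  then show False using c unfolding closed_sequent_def by (metis sat.simps(1,3))
qed

lemma soundness_ranked:
  fixes M :: "('w, 'p, 'a) kripke" and rank :: "'w \<Rightarrow> nat"
  assumes T: "pdl_tableau_for (Free ` \<Phi>) T" "closed_tableau T" and "finite \<Phi>"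
    and M: "kripke_model M" and rank: "\<forall>a w v. (w, v) \<in> acc M a \<longrightarrow> rank v = Suc (rank w)"
    and w0: "w0 \<in> states M" "\<forall>\<phi>\<in>\<Phi>. sat M \<phi> w0"
  shows False
proof -
  obtain C where C: "finite C" "\<Phi> \<subseteq> C" "rule_closed C"
    using rule_closed_superset[OF assms(3)] by blast
  have tab: "tableau_for (Free ` \<Phi>) T" using T by (simp add: pdl_tableau_for_def)
  have inv: "unl ` lab T t \<subseteq> C" "one_loaded (lab T t)" "finite (lab T t)" if "t \<in> nodes T" for t
  proof -
    have "unl ` Free ` \<Phi> \<subseteq> C" using C(2) by (simp add: image_image)
    then show "unl ` lab T t \<subseteq> C" "one_loaded (lab T t)"
      using tableau_label_invariant[OF tab _ _ C(3) that] by auto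
    show "finite (lab T t)" using tab that unfolding tableau_for_def by blast
  qed
  have rule: "rule_inst (applied T t) (lab T t) (lab T ` children T t)" if "interior T t" for t
    using tab that unfolding tableau_for_def by blast
  have leaf_or: "interior T t \<or> leaf T t" if "t \<in> nodes T" for t
    using that by (auto simp: interior_def leaf_def)
  have "wf {(t, s). t \<in> children T s}"
  proof (rule pdl_tableau_wf[OF T(1)])
    show "finite (Pow (unl -` C))" using finite_unl_vimage[OF C(1)] by simp
    show "lab T t \<in> Pow (unl -` C)" if "t \<in> nodes T" for t using inv(1)[OF that] by auto
  qed
  then have wf: "wf ({(t, s). t \<in> children T s}\<^sup>+)" by (rule wf_trancl)
  \<comment> \<open>Below a minimal element of \<open>SF\<close> every satisfied node is loaded, so
    the descent started there is confined to loaded nodes.\<close>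
  define SF where "SF = {s \<in> nodes T. \<not> loaded (lab T s) \<and> (\<exists>w\<in>states M. sats M (lab T s) w)}"
  have root: "[] \<in> SF" using tab w0 unfolding tableau_for_def SF_def by auto
  obtain s where s: "s \<in> SF" and min: "\<And>t. (t, s) \<in> {(t, s). t \<in> children T s}\<^sup>+ \<Longrightarrow> t \<notin> SF"
    using wfE_min[OF wf root] by metis
  have min': "\<not> sats M (lab T t) w" if "t \<in> nodes T" "strict_prefix s t" "\<not> loaded (lab T t)" "w \<in> states M" for t w
    using min[OF extension_trancl_children[OF tab that(1,2)]] that by (auto simp: SF_def)
  have "\<not> leaf T s"
  proof
    assume "leaf T s"
    then have "closed_sequent (lab T s) \<or> loaded_path_repeat T s"
      using T(2) by (simp add: closed_tableau_def)
    moreover have "\<not> closed_sequent (lab T s)" using s by (auto simp: SF_def closed_sequent_unsat)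
    moreover have "\<not> loaded_path_repeat T s"
      using s by (auto simp: SF_def loaded_path_repeat_def companion_def strict_prefix_def)
    ultimately show False by blast
  qed
  then have int: "interior T s" using s leaf_or by (auto simp: SF_def)
  define L where "L = {(t, w, v). t \<in> nodes T \<and> strict_prefix s t \<and>
    (\<forall>d. strict_prefix s d \<and> prefix d t \<longrightarrow> loaded (lab T d)) \<and> w \<in> states M \<and> sats M (lab T t) w \<and>
    witness M (lab T t) w v}"
  \<comment> \<open>The modal rule lowers the first component and the other rules on the way lower
    the second. The third pays for the jump from a leaf to its companion, which keeps label, point
    and endpoint.\<close>
  define meas where "meas = (\<lambda>(t, w, v). (rank v - rank w, weights (lab T t), if leaf T t then 1 else 0 :: nat))"
  have step: "(t', w', v) \<in> L" if c: "t' \<in> children T t" and "t = s \<or> (t, w, v) \<in> L" "w' \<in> states M"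
      "sats M (lab T t') w'" "witness M (lab T t') w' v" for t t' w w' v
  proof -
    have pt: "prefix s t" using that(2) by (auto simp: L_def)
    obtain i where i: "t' = t @ [i]" "t' \<in> nodes T" using c by (auto simp: children_def)
    have "loaded (lab T t')" using that(5) by (auto simp: witness_def loaded_def)
    moreover have "loaded (lab T d)" if "strict_prefix s d" "prefix d t" for d
      using \<open>t = s \<or> (t, w, v) \<in> L\<close> that by (auto simp: L_def)
    ultimately have "\<forall>d. strict_prefix s d \<and> prefix d t' \<longrightarrow> loaded (lab T d)"
      unfolding i(1) prefix_snoc by auto
    moreover have "strict_prefix s t'" using pt i(1) by (auto simp: strict_prefix_def prefix_def)
    ultimately show ?thesis using i(2) that(3-5) by (simp add: L_def)
  qed
  have "L \<noteq> {}"
  proof -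
    obtain w where w: "w \<in> states M" "sats M (lab T s) w" using s by (auto simp: SF_def)
    have nl: "\<not> loaded (lab T s)" using s by (simp add: SF_def)
    then have "applied T s \<notin> {RLDia, RM}" using rule[OF int] by (auto elim: rule_inst.cases)
    from rule_inst_sound[OF rule[OF int] this M w] obtain t where
      t: "t \<in> children T s" "sats M (lab T t) w" by blast
    then have "t \<in> nodes T" "strict_prefix s t" by (auto simp: children_def strict_prefix_def)
    then have "loaded (lab T t)" using min' w(1) t(2) by blast
    then obtain v where wv: "witness M (lab T t) w v" using witness_exists[OF _ t(2)] by blast
    have "(t, w, v) \<in> L" by (rule step[OF t(1) disjI1[OF refl] w(1) t(2) wv])
    then show ?thesis by blast
  qed
  moreover have "wf (inv_image (less_than <*lex*> mult less_than <*lex*> less_than) meas)"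
    by (intro wf_inv_image wf_lex_prod wf_less_than wf_mult)
  ultimately obtain t w v where x: "(t, w, v) \<in> L" and
    xmin: "\<And>y. (meas y, meas (t, w, v)) \<in> less_than <*lex*> mult less_than <*lex*> less_than \<Longrightarrow> y \<notin> L"
    using wfE_min[of "inv_image (less_than <*lex*> mult less_than <*lex*> less_than) meas" _ L]
    by (metis (no_types, lifting) ex_in_conv in_inv_image prod_cases3)
  from x have t: "t \<in> nodes T" "strict_prefix s t" "\<And>d. strict_prefix s d \<Longrightarrow> prefix d t \<Longrightarrow> loaded (lab T d)"
    and w: "w \<in> states M" "sats M (lab T t) w" "witness M (lab T t) w v" by (auto simp: L_def)
  have lt: "loaded (lab T t)" using t by simp
  show False
  proof (cases "leaf T t")
    case True
    then have "closed_sequent (lab T t) \<or> loaded_path_repeat T t"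
      using T(2) by (simp add: closed_tableau_def)
    then have "loaded_path_repeat T t" using closed_sequent_unsat[of "lab T t" M w] w(2) by blast
    then obtain c where c: "companion T t c" "\<And>d. prefix c d \<Longrightarrow> prefix d t \<Longrightarrow> loaded (lab T d)"
      unfolding loaded_path_repeat_def by blast
    have ct: "strict_prefix c t" "lab T c = lab T t" using c(1) by (auto simp: companion_def)
    \<comment> \<open>The path from the companion is loaded but \<open>s\<close> is free, so the
      jump cannot leave the part of the tableau below \<open>s\<close>.\<close>
    have "\<not> prefix c s" using c(2)[of s] t(2) s by (auto simp: SF_def strict_prefix_def)
    then have sc: "strict_prefix s c"
      using ct(1) t(2) by (metis prefix_order.less_imp_le prefix_order.le_less prefix_same_cases)
    have "loaded (lab T d)" if "strict_prefix s d" "prefix d c" for d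
      using t(3) that ct(1) by (meson prefix_order.less_imp_le prefix_order.order_trans)
    then have "(c, w, v) \<in> L"
      using node_prefix[OF tab t(1)] ct sc w by (auto simp: L_def strict_prefix_def)
    moreover have "\<not> leaf T c" using interior_if_extension[OF tab t(1) ct(1)]
      by (auto simp: interior_def leaf_def)
    ultimately show False using xmin[of "(c, w, v)"] ct(2) True by (simp add: meas_def)
  next
    case False
    then have int: "interior T t" using leaf_or t(1) by blast
    from rule_inst_sound_loaded[OF rule[OF int] lt inv(2)[OF t(1)] M rank w] obtain t' w' where
      t': "t' \<in> children T t" and w': "w' \<in> states M" "sats M (lab T t') w'" and
      l': "loaded (lab T t') \<Longrightarrow> witness M (lab T t') w' v \<and> (rank v - rank w' < rank v - rank w \<or>
        w' = w \<and> applied T t \<notin> {RLPlus, RLMinus, RM})" by blast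
    have "t' \<in> nodes T" "strict_prefix t t'" using t' by (auto simp: children_def strict_prefix_def)
    moreover then have "strict_prefix s t'" using t(2) by (meson prefix_order.less_trans)
    ultimately have "loaded (lab T t')" using min' w' by blast
    note l = l'[OF this]
    have "(t', w', v) \<in> L" by (rule step[OF t' disjI2[OF x] w' conjunct1[OF l]])
    moreover have "(meas (t', w', v), meas (t, w, v)) \<in> less_than <*lex*> mult less_than <*lex*> less_than"
      using l local_rule_decreases[OF rule[OF int] _ inv(3)[OF t(1)], of "lab T t'"] t'
      by (auto simp: meas_def)
    ultimately show False using xmin by blast
  qed
qed

section \<open>Ranking an arbitrary model by a step counter\<close>

definition timed :: "('w, 'p, 'a) kripke \<Rightarrow> ('w \<times> nat, 'p, 'a) kripke" where
  "timed M = \<lparr>states = states M \<times> UNIV,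
     acc = (\<lambda>a. {((w, n), (v, Suc n)) | w v n. (w, v) \<in> acc M a}),
     val = (\<lambda>p. val M p \<times> UNIV)\<rparr>"

text \<open>Runs between the same points of \<open>M\<close> may differ in length, so the final
  counter is quantified existentially. The initial counter is arbitrary, which allows runs to be
  concatenated.\<close>

lemma sat_timed: "sat (timed M) \<phi> (w, n) \<longleftrightarrow> sat M \<phi> w"
  and prel_timed: "(\<exists>m. ((w, n), (v, m)) \<in> prel (timed M) \<alpha>) \<longleftrightarrow> (w, v) \<in> prel M \<alpha>"
  for \<phi> :: "('p, 'a) fm" and M :: "('w, 'p, 'a) kripke"
proof (induction \<phi> and \<alpha> arbitrary: w n and w n v rule: fm.induct prog.induct)
  case (Box \<alpha> \<phi>)
  show ?case using Box.IH(2) by (auto simp flip: Box.IH(1)[of w n])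
next
  case (Choice \<alpha> \<beta>)
  show ?case by (simp add: ex_disj_distrib Choice.IH)
next
  case (Seq \<alpha> \<beta>)
  show ?case
  proof
    assume "(w, v) \<in> prel M (Seq \<alpha> \<beta>)"
    then obtain u where "(w, u) \<in> prel M \<alpha>" "(u, v) \<in> prel M \<beta>" by auto
    then show "\<exists>m. ((w, n), (v, m)) \<in> prel (timed M) (Seq \<alpha> \<beta>)"
      using Seq.IH(1)[of w n u] Seq.IH(2)[of u _ v] by (simp) blast
  next
    assume "\<exists>m. ((w, n), (v, m)) \<in> prel (timed M) (Seq \<alpha> \<beta>)"
    then obtain m u k where "((w, n), (u, k)) \<in> prel (timed M) \<alpha>" "((u, k), (v, m)) \<in> prel (timed M) \<beta>"
      by auto
    then have "(w, u) \<in> prel M \<alpha>" "(u, v) \<in> prel M \<beta>" using Seq.IH by blast+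
    then show "(w, v) \<in> prel M (Seq \<alpha> \<beta>)" by auto
  qed
next
  case (Star \<alpha>)
  have "(w, v) \<in> (prel M \<alpha>)\<^sup>*" if "((w, n), (v, m)) \<in> (prel (timed M) \<alpha>)\<^sup>*" for m
    using that
  proof (induction "(v, m)" arbitrary: v m rule: rtrancl_induct)
    case (step y)
    obtain u k where y: "y = (u, k)" by (cases y)
    have "(u, v) \<in> prel M \<alpha>" using step.hyps(2) Star.IH[of u k v] unfolding y by blast
    then show ?case using step.hyps(3)[OF y] by simp
  qed simp
  moreover have "\<exists>m. ((w, n), (v, m)) \<in> (prel (timed M) \<alpha>)\<^sup>*" if "(w, v) \<in> (prel M \<alpha>)\<^sup>*"
    using that
  proof (induction rule: rtrancl_induct)
    case (step u v)
    then obtain k where k: "((w, n), (u, k)) \<in> (prel (timed M) \<alpha>)\<^sup>*" by blast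
    obtain m where "((u, k), (v, m)) \<in> prel (timed M) \<alpha>"
      using Star.IH[of u k v] step.hyps(2) by blast
    from rtrancl.rtrancl_into_rtrancl[OF k this] show ?case by blast
  qed auto
  ultimately show ?case by (auto simp: timed_def)
qed (auto simp: timed_def)

lemma satisfiable_imp_consistent:
  assumes "finite \<Phi>" "satisfiable TYPE('w) \<Phi>"
  shows "consistent \<Phi>"
proof -
  obtain M :: "('w, _, _) kripke" and w where M: "kripke_model M" "w \<in> states M" "\<forall>\<phi>\<in>\<Phi>. sat M \<phi> w"
    using assms(2) by (auto simp: satisfiable_def)
  have "kripke_model (timed M)" using M(1) by (fastforce simp: kripke_model_def timed_def)
  moreover have "\<forall>a x y. (x, y) \<in> acc (timed M) a \<longrightarrow> snd y = Suc (snd x)" by (auto simp: timed_def)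
  moreover have "(w, 0) \<in> states (timed M)" using M(2) by (simp add: timed_def)
  moreover have "\<forall>\<phi>\<in>\<Phi>. sat (timed M) \<phi> (w, 0)" using M(3) by (simp add: sat_timed)
  ultimately have False if "pdl_tableau_for (Free ` \<Phi>) T" "closed_tableau T" for T
    by (rule soundness_ranked[OF that assms(1)])
  then show ?thesis unfolding consistent_def by blast
qed

section \<open>Winning regions of the tableau game\<close>

text \<open>Coinductive because an infinite play through loaded sequents is won by the prover. The
  parameter \<open>W\<close> is the set of free sequents already known to be won.\<close>

coinductive_set prover_loaded :: "('p, 'a) sequent set \<Rightarrow> ('p, 'a) sequent set"
  for W :: "('p, 'a) sequent set" where
  closed: "loaded \<Lambda> \<Longrightarrow> closed_sequent \<Lambda> \<Longrightarrow> \<Lambda> \<in> prover_loaded W"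
| rule: "loaded \<Lambda> \<Longrightarrow> rule_inst r \<Lambda> G \<Longrightarrow> \<forall>\<Gamma>\<in>G. \<Gamma> \<in> W \<or> \<Gamma> \<in> prover_loaded W
    \<Longrightarrow> \<Lambda> \<in> prover_loaded W"

lemma prover_loaded_mono:
  assumes "W \<subseteq> W'"
  shows "prover_loaded W \<subseteq> prover_loaded W'"
proof
  fix \<Lambda> assume "\<Lambda> \<in> prover_loaded W"
  then show "\<Lambda> \<in> prover_loaded W'"
  proof (coinduction arbitrary: \<Lambda> rule: prover_loaded.coinduct)
    case prover_loaded
    then show ?case
    proof cases
      case (rule r G)
      then have "\<forall>\<Gamma>\<in>G. \<Gamma> \<in> W' \<or> \<Gamma> \<in> prover_loaded W \<or> \<Gamma> \<in> prover_loaded W'" using assms by blast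
      with rule(1,2) show ?thesis by (intro disjI2 exI[of _ \<Lambda>] exI[of _ r] exI[of _ G]) auto
    qed simp
  qed
qed

lemma prover_loaded_loaded: "\<Lambda> \<in> prover_loaded W \<Longrightarrow> loaded \<Lambda>"
  by (erule prover_loaded.cases) simp_all

text \<open>The set \<open>C\<close> keeps the iteration within finitely many sequents. The loaded
  sequents won are recomputed as a greatest fixed point at each stage from the free ones won so
  far.\<close>

definition prover_step :: "('p, 'a) fm set \<Rightarrow> ('p, 'a) sequent set \<Rightarrow> ('p, 'a) sequent set" where
  "prover_step C W = {\<Gamma>. unl ` \<Gamma> \<subseteq> C \<and> \<not> loaded \<Gamma> \<and> (closed_sequent \<Gamma> \<or>
     (\<exists>r G. rule_inst r \<Gamma> G \<and> (\<forall>\<Gamma>'\<in>G. \<Gamma>' \<in> W \<or> \<Gamma>' \<in> prover_loaded W)))}"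

lemma prover_step_mono: "W \<subseteq> W' \<Longrightarrow> prover_step C W \<subseteq> prover_step C W'"
  using prover_loaded_mono[of W W'] unfolding prover_step_def by blast

definition prover_stage :: "('p, 'a) fm set \<Rightarrow> nat \<Rightarrow> ('p, 'a) sequent set" where
  "prover_stage C n = (prover_step C ^^ n) {}"

lemma prover_stage_simps [simp]:
  "prover_stage C 0 = {}" "prover_stage C (Suc n) = prover_step C (prover_stage C n)"
  by (simp_all add: prover_stage_def)

lemma prover_stage_not_loaded: "\<Gamma> \<in> prover_stage C n \<Longrightarrow> \<not> loaded \<Gamma>"
  by (cases n) (auto simp: prover_step_def)

text \<open>Stages increase inside a finite set, so natural numbers suffice to reach the least fixed
  point.\<close>

lemma prover_stage_stable:
  assumes "finite C"
  shows "\<exists>n. prover_step C (prover_stage C n) = prover_stage C n"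
proof (rule ccontr)
  assume no: "\<nexists>n. prover_step C (prover_stage C n) = prover_stage C n"
  have inc: "prover_stage C n \<subseteq> prover_stage C (Suc n)" for n
  proof (induction n)
    case (Suc n)
    then show ?case using prover_step_mono[OF Suc] by simp
  qed simp
  have fin: "finite (Pow (unl -` C))" using finite_unl_vimage[OF assms] by simp
  have sub: "prover_stage C n \<subseteq> Pow (unl -` C)" for n
    by (cases n) (auto simp: prover_step_def)
  have "n \<le> card (prover_stage C n)" for n
  proof (induction n)
    case (Suc n)
    have "prover_stage C n \<noteq> prover_stage C (Suc n)" using no by auto
    then have "prover_stage C n \<subset> prover_stage C (Suc n)" using inc[of n] by blast
    moreover have "finite (prover_stage C (Suc n))" using sub fin finite_subset by blast
    ultimately have "card (prover_stage C n) < card (prover_stage C (Suc n))"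
      by (intro psubset_card_mono)
    then show ?case using Suc by linarith
  qed simp
  moreover have "card (prover_stage C n) \<le> card (Pow (unl -` C))" for n
    using sub fin by (intro card_mono)
  ultimately have "n \<le> card (Pow (unl -` C))" for n using order_trans by blast
  then show False using not_less_eq_eq by blast
qed

section \<open>From the winning region to a closed tableau\<close>

text \<open>The only loaded formula is the one just marked, and unloading it restores
  \<open>\<Gamma>\<close>. A strategy that never returns to a free sequent therefore respects the
  ban on (L-) after (L+) by itself.\<close>

lemma lminus_after_lplus:
  assumes "rule_inst RLPlus \<Gamma> G" "\<Lambda> \<in> G" "rule_inst RLMinus \<Lambda> G'"
  shows "G' = {\<Gamma>}"
  using assms(1)
proof cases
  case (lplus a \<delta> \<phi> \<Delta>)
  have \<Lambda>: "\<Lambda> = \<Delta> \<union> {Loaded (Atom a) (lboxes \<delta> (Plain \<phi>))}" using lplus assms(2) by simp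
  from assms(3) show ?thesis
  proof cases
    case (lminus \<eta> \<psi> \<Delta>')
    obtain \<alpha> \<xi> where l: "lneg (lboxes \<eta> (Plain \<psi>)) = Loaded \<alpha> \<xi>"
      using lneg_lboxes_Loaded[OF lminus(3)] by blast
    have "Loaded \<alpha> \<xi> \<in> \<Lambda>" using lminus(1) l by simp
    then have eq: "Loaded \<alpha> \<xi> = Loaded (Atom a) (lboxes \<delta> (Plain \<phi>))"
      using \<Lambda> lplus by (auto simp: loaded_def)
    have "Loaded \<alpha> \<xi> \<notin> \<Delta>" using lplus by (auto simp: loaded_def)
    moreover have "Loaded \<alpha> \<xi> \<notin> \<Delta>'" using lminus l by simp
    ultimately have "\<Delta>' = \<Delta>"
      using lminus(1) \<Lambda> l eq by (metis Un_insert_right insert_ident sup_bot_right)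
    moreover have "Neg (boxes \<eta> \<psi>) = unl (Loaded \<alpha> \<xi>)" unfolding l[symmetric] by simp
    then have "Neg (boxes \<eta> \<psi>) = Neg (Box (Atom a) (boxes \<delta> \<phi>))" unfolding eq by simp
    ultimately show ?thesis using lminus lplus by simp
  qed
qed

text \<open>The number bounds the stages of all free sequents at or below the current node.\<close>

definition prover_position :: "('p, 'a) fm set \<Rightarrow> ('p, 'a) sequent \<times> nat \<Rightarrow> bool" where
  "prover_position C = (\<lambda>(\<Lambda>, n). finite \<Lambda> \<and> (\<Lambda> \<in> prover_stage C n \<or> \<Lambda> \<in> prover_loaded (prover_stage C n)))"

definition stage_rank :: "('p, 'a) fm set \<Rightarrow> ('p, 'a) sequent \<Rightarrow> nat" where
  "stage_rank C \<Gamma> = (LEAST n. \<Gamma> \<in> prover_stage C n)"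

text \<open>A free sequent owes its least stage to positions won one stage earlier, so the bound can
  drop. A loaded one is won relative to the current stage, and the bound is kept.\<close>

lemma prover_move:
  assumes "prover_position C (\<Lambda>, n)" "\<not> closed_sequent \<Lambda>"
  shows "\<exists>r xs m. rule_inst r \<Lambda> (set xs) \<and> (\<forall>\<Gamma>\<in>set xs. prover_position C (\<Gamma>, m)) \<and>
    m \<le> n \<and> (\<not> loaded \<Lambda> \<longrightarrow> m < stage_rank C \<Lambda>)"
proof -
  have fin: "finite \<Lambda>" using assms(1) by (simp add: prover_position_def)
  obtain r G m where G: "rule_inst r \<Lambda> G" "m \<le> n" "\<not> loaded \<Lambda> \<longrightarrow> m < stage_rank C \<Lambda>"
    "\<forall>\<Gamma>\<in>G. \<Gamma> \<in> prover_stage C m \<or> \<Gamma> \<in> prover_loaded (prover_stage C m)"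
  proof (cases "loaded \<Lambda>")
    case True
    then have "\<Lambda> \<in> prover_loaded (prover_stage C n)"
      using assms(1) prover_stage_not_loaded by (auto simp: prover_position_def)
    then show ?thesis by cases (use assms(2) True that[of _ _ n] in auto)
  next
    case False
    then have n: "\<Lambda> \<in> prover_stage C n"
      using assms(1) prover_loaded_loaded by (auto simp: prover_position_def)
    then have k: "\<Lambda> \<in> prover_stage C (stage_rank C \<Lambda>)" "stage_rank C \<Lambda> \<le> n"
      unfolding stage_rank_def by (rule LeastI, rule Least_le)
    then obtain m where m: "stage_rank C \<Lambda> = Suc m" by (cases "stage_rank C \<Lambda>") auto
    then have "\<Lambda> \<in> prover_step C (prover_stage C m)" using k(1) by simp
    then obtain r G where "rule_inst r \<Lambda> G" "\<forall>\<Gamma>\<in>G. \<Gamma> \<in> prover_stage C m \<or> \<Gamma> \<in> prover_loaded (prover_stage C m)"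
      using assms(2) unfolding prover_step_def by blast
    then show ?thesis using that[of r G m] k(2) m by simp
  qed
  obtain xs where "set xs = G" using rule_inst_finite(1)[OF G(1) fin] finite_list by blast
  then show ?thesis using G rule_inst_finite(2)[OF G(1) fin] unfolding prover_position_def by blast
qed

text \<open>The strategy is unravelled until a node is closed or a loaded-path repeat. As closedness
  speaks of leaves only, the essential point is to exclude free repeats.\<close>

lemma closed_tableau_exists:
  assumes "\<Gamma> \<in> prover_stage C N" "finite \<Gamma>"
  shows "\<exists>T. pdl_tableau_for \<Gamma> T \<and> closed_tableau T"
proof -
  have "\<forall>q. \<exists>r xs m. prover_position C q \<and> \<not> closed_sequent (fst q) \<longrightarrow>
      rule_inst r (fst q) (set xs) \<and> (\<forall>\<Gamma>\<in>set xs. prover_position C (\<Gamma>, m)) \<and>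
      m \<le> snd q \<and> (\<not> loaded (fst q) \<longrightarrow> m < stage_rank C (fst q))"
    using prover_move by (metis prod.collapse)
  then obtain rl kids nx where strategy: "\<And>q. prover_position C q \<Longrightarrow> \<not> closed_sequent (fst q) \<Longrightarrow>
      rule_inst (rl q) (fst q) (set (kids q)) \<and> (\<forall>\<Gamma>\<in>set (kids q). prover_position C (\<Gamma>, nx q)) \<and>
      nx q \<le> snd q \<and> (\<not> loaded (fst q) \<longrightarrow> nx q < stage_rank C (fst q))"
    by metis
  \<comment> \<open>A position is replayed from the root; indices beyond the number of children
    yield arbitrary values, which the node set of \<open>T\<close> excludes.\<close>
  define st where "st = foldl (\<lambda>q i. (kids q ! i, nx q)) (\<Gamma>, N)"
  have st_snoc: "st (s @ [i]) = (kids (st s) ! i, nx (st s))" for s i by (simp add: st_def)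
  \<comment> \<open>Whether \<open>s\<close> is a loaded-path repeat depends on the node set only
    through membership of \<open>s\<close>. The stopping condition can therefore be evaluated in the
    tree of all positions, before \<open>T\<close> is cut out of it.\<close>
  define full where "full = \<lparr>nodes = UNIV, lab = fst \<circ> st, applied = rl \<circ> st\<rparr>"
  define stop where "stop s \<longleftrightarrow> closed_sequent (fst (st s)) \<or> loaded_path_repeat full s" for s
  define T where "T = full\<lparr>nodes := {s. \<forall>p i. prefix (p @ [i]) s \<longrightarrow> \<not> stop p \<and> i < length (kids (st p))}\<rparr>"
  have lab: "lab T s = fst (st s)" and app: "applied T s = rl (st s)" for s
    by (simp_all add: T_def full_def)
  have node: "s \<in> nodes T \<longleftrightarrow> (\<forall>p i. prefix (p @ [i]) s \<longrightarrow> \<not> stop p \<and> i < length (kids (st p)))" for s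
    by (simp add: T_def)
  have Nil: "[] \<in> nodes T" by (simp add: node)
  have node_snoc: "s @ [i] \<in> nodes T \<longleftrightarrow> s \<in> nodes T \<and> \<not> stop s \<and> i < length (kids (st s))" for s i
    unfolding node by (auto simp: prefix_snoc)
  have pos: "prover_position C (st s)" if "s \<in> nodes T" for s
    using that
  proof (induction s rule: rev_induct)
    case Nil
    then show ?case using assms by (simp add: st_def prover_position_def)
  next
    case (snoc i s)
    then have "s \<in> nodes T" "\<not> stop s" "i < length (kids (st s))" using node_snoc by blast+
    then show ?case using snoc.IH strategy[of "st s"] by (simp add: st_snoc stop_def)
  qed
  have strat: "rule_inst (rl (st s)) (fst (st s)) (set (kids (st s)))" "nx (st s) \<le> snd (st s)"
    "\<not> loaded (fst (st s)) \<Longrightarrow> nx (st s) < stage_rank C (fst (st s))"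
    if "s \<in> nodes T" "\<not> stop s" for s
    using strategy[OF pos[OF that(1)]] that(2) by (auto simp: stop_def)
  have children: "children T s = (if stop s then {} else (\<lambda>i. s @ [i]) ` {..<length (kids (st s))})"
    if "s \<in> nodes T" for s
    using that node_snoc by (auto simp: children_def)
  have lab_children: "lab T ` children T s = set (kids (st s))" if "s \<in> nodes T" "\<not> stop s" for s
  proof -
    have "lab T ` children T s = (\<lambda>i. kids (st s) ! i) ` {..<length (kids (st s))}"
      using that by (simp add: children image_image lab st_snoc)
    then show ?thesis by (auto simp: set_conv_nth)
  qed
  have kids: "kids (st s) \<noteq> []" if "s \<in> nodes T" "\<not> stop s" for s
    using rule_inst_nonempty[OF strat(1)[OF that]] by auto
  have leaf_stop: "leaf T s \<longleftrightarrow> s \<in> nodes T \<and> stop s" for s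
    using kids[of s] by (cases "s \<in> nodes T"; cases "stop s") (auto simp: leaf_def children)
  have interior_stop: "interior T s \<longleftrightarrow> s \<in> nodes T \<and> \<not> stop s" for s
    using kids[of s] by (cases "s \<in> nodes T"; cases "stop s") (auto simp: interior_def children)
  have lpr: "loaded_path_repeat T s \<longleftrightarrow> s \<in> nodes T \<and> loaded_path_repeat full s" for s
    by (auto simp: loaded_path_repeat_def companion_def T_def full_def)
  have desc: "snd (st (s @ xs)) \<le> snd (st s)" if "s @ xs \<in> nodes T" for s xs
    using that
  proof (induction xs rule: rev_induct)
    case (snoc x xs)
    then have "(s @ xs) @ [x] \<in> nodes T" by simp
    then have n: "s @ xs \<in> nodes T" "\<not> stop (s @ xs)" unfolding node_snoc by blast+
    have "st (s @ xs @ [x]) = (kids (st (s @ xs)) ! x, nx (st (s @ xs)))"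
      using st_snoc[of "s @ xs" x] by simp
    then show ?case using snoc.IH[OF n(1)] strat(2)[OF n] by simp
  qed simp
  \<comment> \<open>Just below a free node the bound is smaller than the stage of its label, and it
    never rises again. A free node belongs to the stage given by its bound, so the label cannot
    recur.\<close>
  have fresh: "lab T t \<noteq> lab T s" if t: "t \<in> nodes T" "strict_prefix s t" and free: "\<not> loaded (lab T s)" for s t
  proof
    assume eq: "lab T t = lab T s"
    obtain i xs where t_eq: "t = (s @ [i]) @ xs"
      using t(2) by (metis strict_prefixE' append.assoc append_Cons append_Nil)
    then have "prefix (s @ [i]) t" by simp
    then have si: "s @ [i] \<in> nodes T" using t(1) unfolding node by (meson prefix_order.order_trans)
    then have s: "s \<in> nodes T" "\<not> stop s" unfolding node_snoc by blast+
    have "snd (st t) \<le> nx (st s)"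
      using desc[of "s @ [i]" xs] t(1) unfolding t_eq by (simp add: st_snoc)
    also have "\<dots> < stage_rank C (lab T s)" using strat(3)[OF s] free by (simp add: lab)
    finally have "snd (st t) < stage_rank C (lab T t)" using eq by simp
    moreover have "lab T t \<in> prover_stage C (snd (st t))"
      using pos[OF t(1)] free eq prover_loaded_loaded
        by (auto simp: prover_position_def lab split: prod.splits)
    ultimately show False unfolding stage_rank_def using not_less_Least by blast
  qed
  have "tableau_for \<Gamma> T"
    unfolding tableau_for_def
  proof (intro conjI allI ballI impI)
    show "[] \<in> nodes T" by (rule Nil)
    show "s \<in> nodes T" if "s @ [i] \<in> nodes T" for s i using that node_snoc by blast
    show "finite (children T s)" if "s \<in> nodes T" for s using that by (simp add: children)
    show "finite (lab T s)" if "s \<in> nodes T" for s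
      using pos[OF that] by (simp add: lab prover_position_def split: prod.splits)
    show "lab T [] = \<Gamma>" by (simp add: lab st_def)
    show "rule_inst (applied T s) (lab T s) (lab T ` children T s)" if "interior T s" for s
      using that strat(1)[of s] lab_children[of s] by (simp add: interior_stop app lab)
    show "applied T t \<noteq> RLMinus"
      if *: "interior T s \<and> t \<in> children T s \<and> interior T t \<and> applied T s = RLPlus" for s t
    proof
      assume minus: "applied T t = RLMinus"
      have s: "s \<in> nodes T" "\<not> stop s" and t: "t \<in> nodes T" "\<not> stop t"
        using * by (auto simp: interior_stop)
      have rs: "rule_inst RLPlus (lab T s) (lab T ` children T s)"
        using strat(1)[OF s] lab_children[OF s] * by (simp add: app lab)
      have rt: "rule_inst RLMinus (lab T t) (lab T ` children T t)"
        using strat(1)[OF t] lab_children[OF t] minus by (simp add: app lab)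
      have "lab T ` children T t = {lab T s}" using lminus_after_lplus[OF rs _ rt] * by blast
      then have "lab T s \<in> lab T ` children T t" by simp
      then obtain u where u: "u \<in> children T t" "lab T u = lab T s" by (metis imageE)
      have "\<not> loaded (lab T s)" using rs by cases auto
      moreover have "u \<in> nodes T" "strict_prefix s u"
        using u(1) * by (auto simp: children_def strict_prefix_def)
      ultimately show False using fresh[of u s] u(2) by blast
    qed
  qed
  moreover have "leaf T s" if "loaded_path_repeat T s \<or> free_repeat T s" for s
    using that
  proof
    assume "loaded_path_repeat T s"
    then show ?thesis by (simp add: lpr leaf_stop stop_def)
  next
    assume "free_repeat T s"
    then obtain c where "s \<in> nodes T" "strict_prefix c s" "lab T s = lab T c" "\<not> loaded (lab T c)"
      by (auto simp: free_repeat_def repeat_def)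
    then show ?thesis using fresh[of s c] by simp
  qed
  moreover have "closed_tableau T"
    unfolding closed_tableau_def by (auto simp: leaf_stop stop_def lab lpr)
  ultimately show ?thesis unfolding pdl_tableau_for_def by blast
qed

section \<open>Completeness\<close>

text \<open>The closure of a basic sequent under the local rules read from children to parent.\<close>

inductive der :: "('p, 'a) sequent \<Rightarrow> ('p, 'a) fm \<Rightarrow> bool" for \<Gamma> :: "('p, 'a) sequent" where
  base: "Free \<phi> \<in> \<Gamma> \<Longrightarrow> basic {Free \<phi>} \<Longrightarrow> der \<Gamma> \<phi>"
| neg: "der \<Gamma> \<phi> \<Longrightarrow> der \<Gamma> (Neg (Neg \<phi>))"
| con: "der \<Gamma> \<phi> \<Longrightarrow> der \<Gamma> \<psi> \<Longrightarrow> der \<Gamma> (Con \<phi> \<psi>)"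
| neg_con1: "der \<Gamma> (Neg \<phi>) \<Longrightarrow> der \<Gamma> (Neg (Con \<phi> \<psi>))"
| neg_con2: "der \<Gamma> (Neg \<psi>) \<Longrightarrow> der \<Gamma> (Neg (Con \<phi> \<psi>))"
| box: "\<not> atomic \<alpha> \<Longrightarrow> \<forall>\<chi>\<in>X l \<alpha> \<psi>. der \<Gamma> \<chi> \<Longrightarrow> der \<Gamma> (Box \<alpha> \<psi>)"
| dia: "\<not> atomic \<alpha> \<Longrightarrow> (Y, \<delta>) \<in> H \<alpha> \<Longrightarrow> \<forall>\<chi>\<in>Y. der \<Gamma> \<chi> \<Longrightarrow> der \<Gamma> (Neg (boxes \<delta> \<psi>))
    \<Longrightarrow> der \<Gamma> (Neg (Box \<alpha> \<psi>))"

lemma basic_Free_simps [simp]: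
  "\<not> basic {Free (Neg (Neg \<phi>))}" "\<not> basic {Free (Con \<phi> \<psi>)}" "\<not> basic {Free (Neg (Con \<phi> \<psi>))}"
  "basic {Free (Box \<alpha> \<phi>)} \<longleftrightarrow> atomic \<alpha>" "basic {Free (Neg (Box \<alpha> \<phi>))} \<longleftrightarrow> atomic \<alpha>"
  by (auto simp: basic_def atomic_def)

lemma atomic_Atom [simp]: "atomic (Atom a)"
  by (simp add: atomic_def)

lemma der_inversions:
  "der \<Gamma> Bot \<Longrightarrow> Free Bot \<in> \<Gamma>"
  "der \<Gamma> (Var p) \<Longrightarrow> Free (Var p) \<in> \<Gamma>"
  "der \<Gamma> (Neg (Var p)) \<Longrightarrow> Free (Neg (Var p)) \<in> \<Gamma>"
  "der \<Gamma> (Neg (Neg \<phi>)) \<Longrightarrow> der \<Gamma> \<phi>"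
  "der \<Gamma> (Con \<phi> \<psi>) \<Longrightarrow> der \<Gamma> \<phi> \<and> der \<Gamma> \<psi>"
  "der \<Gamma> (Neg (Con \<phi> \<psi>)) \<Longrightarrow> der \<Gamma> (Neg \<phi>) \<or> der \<Gamma> (Neg \<psi>)"
  "der \<Gamma> (Box (Atom a) \<psi>) \<Longrightarrow> Free (Box (Atom a) \<psi>) \<in> \<Gamma>"
  "der \<Gamma> (Neg (Box (Atom a) \<psi>)) \<Longrightarrow> Free (Neg (Box (Atom a) \<psi>)) \<in> \<Gamma>"
  by (erule der.cases; auto)+

text \<open>For an atomic program the box is itself the only member of \<open>X\<close>, so
  inversion takes the same form for all programs.\<close>

lemma der_box_cases:
  assumes "der \<Gamma> (Box \<alpha> \<psi>)"
  obtains l where "\<And>\<chi>. \<chi> \<in> X l \<alpha> \<psi> \<Longrightarrow> der \<Gamma> \<chi>"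
proof (cases "atomic \<alpha>")
  case True
  then obtain a where "\<alpha> = Atom a" by (auto simp: atomic_def)
  then have "der \<Gamma> \<chi>" if "\<chi> \<in> X {} \<alpha> \<psi>" for \<chi> using that assms by (auto simp: in_X_iff)
  then show ?thesis by (rule that)
next
  case False
  show ?thesis using assms by cases (use False that in auto)
qed

lemma der_dia_cases:
  assumes "der \<Gamma> (Neg (Box \<alpha> \<psi>))" "\<not> atomic \<alpha>"
  obtains Y \<delta> where "(Y, \<delta>) \<in> H \<alpha>" "\<forall>\<chi>\<in>Y. der \<Gamma> \<chi>" "der \<Gamma> (Neg (boxes \<delta> \<psi>))"
  using assms(1) by cases (use assms(2) that in auto)

lemma der_boxI:
  assumes "\<And>\<chi>. \<chi> \<in> X l \<alpha> \<psi> \<Longrightarrow> der \<Gamma> \<chi>"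
  shows "der \<Gamma> (Box \<alpha> \<psi>)"
proof (cases "atomic \<alpha>")
  case True
  then obtain a where "\<alpha> = Atom a" by (auto simp: atomic_def)
  then show ?thesis using assms[of "Box \<alpha> \<psi>"] by (auto simp: in_X_iff)
qed (use assms der.box in blast)

text \<open>One \<open>l\<close> serves both sides. Nonempty lists of \<open>\<alpha>\<close> are
  extended by \<open>\<beta>\<close> exactly as in the clause for \<open>Seq\<close>; an empty list
  leaves \<open>Box \<beta> \<psi>\<close>, whose unfolding is then part of that of the
  sequence.\<close>

lemma der_box_Seq:
  assumes "der \<Gamma> (Box (Seq \<alpha> \<beta>) \<psi>)"
  shows "der \<Gamma> (Box \<alpha> (Box \<beta> \<psi>))"
proof -
  obtain l where l: "\<And>\<chi>. \<chi> \<in> X l (Seq \<alpha> \<beta>) \<psi> \<Longrightarrow> der \<Gamma> \<chi>" using der_box_cases[OF assms] by blast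
  have e: "der \<Gamma> (Box \<beta> \<psi>)" if "[] \<in> P l \<alpha>"
  proof (rule der_boxI)
    fix \<chi> assume "\<chi> \<in> X l \<beta> \<psi>"
    then show "der \<Gamma> \<chi>" using that by (intro l) (auto simp: in_X_iff)
  qed
  show ?thesis
  proof (rule der_boxI)
    fix \<chi> assume "\<chi> \<in> X l \<alpha> (Box \<beta> \<psi>)"
    then consider \<tau> where "\<chi> = Neg \<tau>" "\<tau> \<in> tests \<alpha>" "\<tau> \<notin> l"
      | \<delta> where "\<chi> = boxes (\<delta> @ [\<beta>]) \<psi>" "\<delta> \<in> P l \<alpha>" by (auto simp: in_X_iff)
    then show "der \<Gamma> \<chi>"
    proof cases
      case 1
      then show ?thesis by (intro l) (auto simp: in_X_iff)
    next
      case 2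
      show ?thesis
      proof (cases "\<delta> = []")
        case True
        then show ?thesis using e 2 by simp
      next
        case False
        then have "\<delta> @ [\<beta>] \<in> P l (Seq \<alpha> \<beta>)" using 2 by auto
        then show ?thesis using 2(1) by (intro l) (unfold in_X_iff, blast)
      qed
    qed
  qed
qed

text \<open>Nonempty lists of the body occur in the clause for \<open>Star\<close>; an empty list
  leads back to \<open>Box (Star \<alpha>) \<psi>\<close>, which is derivable by assumption.\<close>

lemma der_box_Star:
  assumes "der \<Gamma> (Box (Star \<alpha>) \<psi>)"
  shows "der \<Gamma> \<psi>" "der \<Gamma> (Box \<alpha> (Box (Star \<alpha>) \<psi>))"
proof -
  obtain l where l: "\<And>\<chi>. \<chi> \<in> X l (Star \<alpha>) \<psi> \<Longrightarrow> der \<Gamma> \<chi>" using der_box_cases[OF assms] by blast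
  show "der \<Gamma> \<psi>" by (rule l) (auto simp: in_X_iff)
  show "der \<Gamma> (Box \<alpha> (Box (Star \<alpha>) \<psi>))"
  proof (rule der_boxI)
    fix \<chi> assume "\<chi> \<in> X l \<alpha> (Box (Star \<alpha>) \<psi>)"
    then consider \<tau> where "\<chi> = Neg \<tau>" "\<tau> \<in> tests \<alpha>" "\<tau> \<notin> l"
      | \<delta> where "\<chi> = boxes (\<delta> @ [Star \<alpha>]) \<psi>" "\<delta> \<in> P l \<alpha>" by (auto simp: in_X_iff)
    then show "der \<Gamma> \<chi>"
    proof cases
      case 1
      then show ?thesis by (intro l) (auto simp: in_X_iff)
    next
      case 2
      show ?thesis
      proof (cases "\<delta> = []")
        case True
        then show ?thesis using assms 2 by simp
      next
        case False
        then have "\<delta> @ [Star \<alpha>] \<in> P l (Star \<alpha>)" using 2 by auto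
        then show ?thesis using 2(1) by (intro l) (unfold in_X_iff, blast)
      qed
    qed
  qed
qed

lemma basic_Free: "\<not> loaded \<Gamma> \<Longrightarrow> basic \<Gamma> \<longleftrightarrow> (\<forall>\<phi>. Free \<phi> \<in> \<Gamma> \<longrightarrow> basic {Free \<phi>})"
  unfolding basic_def loaded_def by (metis (no_types, lifting) sfm.exhaust singletonD singletonI)

text \<open>The rule ignores the remaining formulas, so it serves free and loaded sequents alike.
  Derivability is transferred for every \<open>\<Delta>\<close> because the state at which it will
  be needed is found only later.\<close>

lemma expand_nonbasic:
  assumes "Free \<phi> \<in> \<Gamma>" "\<not> basic {Free \<phi>}"
  shows "\<exists>r G. rule_inst r \<Gamma> G \<and> r \<notin> {RLPlus, RLMinus, RM} \<and>
    (\<forall>\<Gamma>'\<in>G. \<exists>Y. \<Gamma>' = (\<Gamma> - {Free \<phi>}) \<union> Free ` Y \<and> (\<forall>\<Delta>. (\<forall>\<chi>\<in>Y. der \<Delta> \<chi>) \<longrightarrow> der \<Delta> \<phi>))"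
proof -
  let ?\<Delta> = "\<Gamma> - {Free \<phi>}"
  have \<Gamma>: "?\<Delta> \<union> {Free \<phi>} = \<Gamma>" "Free \<phi> \<notin> ?\<Delta>" using assms(1) by auto
  have intro: ?thesis if "rule_inst r (?\<Delta> \<union> {Free \<phi>}) {?\<Delta> \<union> Free ` Y | Y. Y \<in> Ys}"
    "r \<notin> {RLPlus, RLMinus, RM}" "\<And>Y \<Delta>. Y \<in> Ys \<Longrightarrow> \<forall>\<chi>\<in>Y. der \<Delta> \<chi> \<Longrightarrow> der \<Delta> \<phi>" for r Ys
    using that unfolding \<Gamma>(1)
    by (intro exI[of _ r] exI[of _ "{?\<Delta> \<union> Free ` Y | Y. Y \<in> Ys}"]) auto
  consider \<psi> where "\<phi> = Neg (Neg \<psi>)" | \<psi> \<chi> where "\<phi> = Con \<psi> \<chi>" | \<psi> \<chi> where "\<phi> = Neg (Con \<psi> \<chi>)"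
    | \<alpha> \<psi> where "\<phi> = Box \<alpha> \<psi>" "\<not> atomic \<alpha>" | \<alpha> \<psi> where "\<phi> = Neg (Box \<alpha> \<psi>)" "\<not> atomic \<alpha>"
  proof -
    have "basic {Free (Bot :: ('a, 'b) fm)}" "basic {Free (Neg Bot :: ('a, 'b) fm)}"
      "\<And>p. basic {Free (Var p :: ('a, 'b) fm)}" "\<And>p. basic {Free (Neg (Var p) :: ('a, 'b) fm)}"
      by (auto simp: basic_def)
    then show ?thesis using assms(2) that
      by (cases \<phi>) (auto, (rename_tac \<psi>, case_tac \<psi>, auto)?)
  qed
  then show ?thesis
  proof cases
    case (1 \<psi>)
    have "{?\<Delta> \<union> Free ` Y | Y. Y \<in> {{\<psi>}}} = {?\<Delta> \<union> {Free \<psi>}}" by auto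
    then show ?thesis
      using rule_inst.neg[of \<psi> ?\<Delta>] \<Gamma>(2) 1 by (intro intro[of RNeg "{{\<psi>}}"]) (auto intro: der.neg)
  next
    case (2 \<psi> \<chi>)
    have "{?\<Delta> \<union> Free ` Y | Y. Y \<in> {{\<psi>, \<chi>}}} = {?\<Delta> \<union> {Free \<psi>, Free \<chi>}}" by auto
    then show ?thesis
      using rule_inst.con[of \<psi> \<chi> ?\<Delta>] \<Gamma>(2) 2
        by (intro intro[of RCon "{{\<psi>, \<chi>}}"]) (auto intro: der.con)
  next
    case (3 \<psi> \<chi>)
    have "{?\<Delta> \<union> Free ` Y | Y. Y \<in> {{Neg \<psi>}, {Neg \<chi>}}} = {?\<Delta> \<union> {Free (Neg \<psi>)}, ?\<Delta> \<union> {Free (Neg \<chi>)}}"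
      by auto
    then show ?thesis
      using rule_inst.neg_con[of \<psi> \<chi> ?\<Delta>] \<Gamma>(2) 3
      by (intro intro[of RNegCon "{{Neg \<psi>}, {Neg \<chi>}}"]) (auto intro: der.neg_con1 der.neg_con2)
  next
    case (4 \<alpha> \<psi>)
    then show ?thesis using rule_inst.box[of \<alpha> \<psi> ?\<Delta>] \<Gamma>(2)
      by (intro intro[of RBox "unfold_box \<alpha> \<psi>"]) (auto simp: unfold_box_def intro: der.box)
  next
    case (5 \<alpha> \<psi>)
    then show ?thesis using rule_inst.dia[of \<alpha> \<psi> ?\<Delta>] \<Gamma>(2)
      by (intro intro[of RDia "unfold_dia \<alpha> \<psi>"]) (auto simp: unfold_dia_def intro: der.dia)
  qed
qed

lemma size_tests: "\<tau> \<in> tests \<alpha> \<Longrightarrow> size \<tau> < size \<alpha>"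
  by (induction \<alpha> rule: prog_induct) auto

lemma size_boxes:
  "size \<phi> \<le> size (boxes \<delta> \<phi>)"
  "\<alpha> \<in> set \<delta> \<Longrightarrow> size \<alpha> < size (boxes \<delta> \<phi>)"
  by (induction \<delta>) auto

text \<open>This is the maximal block of boxes that (L+) has to mark.\<close>

lemma strip_boxes: "\<exists>\<delta> \<psi>. \<phi> = boxes \<delta> \<psi> \<and> (\<nexists>\<alpha> \<chi>. \<psi> = Box \<alpha> \<chi>)"
proof (induction \<phi> rule: measure_induct_rule[of size])
  case (less \<phi>)
  show ?case
  proof (cases "\<exists>\<alpha> \<chi>. \<phi> = Box \<alpha> \<chi>")
    case True
    then obtain \<alpha> \<chi> where \<phi>: "\<phi> = Box \<alpha> \<chi>" by blast
    then obtain \<delta> \<psi> where "\<chi> = boxes \<delta> \<psi>" "\<nexists>\<alpha> \<chi>. \<psi> = Box \<alpha> \<chi>" using less[of \<chi>] by auto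
    then have "\<phi> = boxes (\<alpha> # \<delta>) \<psi> \<and> (\<nexists>\<alpha> \<chi>. \<psi> = Box \<alpha> \<chi>)" using \<phi> by simp
    then show ?thesis by blast
  next
    case False
    then have "\<phi> = boxes [] \<phi> \<and> (\<nexists>\<alpha> \<chi>. \<phi> = Box \<alpha> \<chi>)" by simp
    then show ?thesis by blast
  qed
qed

text \<open>\<open>W\<close> contains every free sequent won by the prover; \<open>g\<close> labels the points of the type from
  which states are to be drawn.\<close>

locale builder =
  fixes C :: "('p, 'a) fm set" and W :: "('p, 'a) sequent set"
    and S :: "'w set" and g :: "'w \<Rightarrow> ('p, 'a) sequent"
  assumes C: "finite C" "rule_closed C" and W: "prover_step C W \<subseteq> W"
    and g: "g ` S = {\<Gamma>. basic \<Gamma> \<and> unl ` \<Gamma> \<subseteq> C \<and> \<Gamma> \<notin> W}"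
begin

abbreviation D :: "('p, 'a) fm \<Rightarrow> 'w \<Rightarrow> bool" where
  "D \<phi> w \<equiv> der (g w) \<phi>"

definition R :: "'a \<Rightarrow> ('w \<times> 'w) set" where
  "R a = {(w, v). w \<in> S \<and> v \<in> S \<and> (\<forall>\<phi>. Free (Box (Atom a) \<phi>) \<in> g w \<longrightarrow> D \<phi> v)}"

definition M :: "('w, 'p, 'a) kripke" where
  "M = \<lparr>states = S, acc = R, val = (\<lambda>p. {w \<in> S. Free (Var p) \<in> g w})\<rparr>"

lemma RS: "\<forall>a. R a \<subseteq> S \<times> S"
  by (auto simp: R_def)

lemma not_prover_step: "\<Gamma> \<notin> W \<Longrightarrow> \<Gamma> \<notin> prover_step C W"
  using W by blast

lemma S_D:
  assumes "w \<in> S"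
  shows "basic (g w)" "unl ` g w \<subseteq> C" "g w \<notin> W" "\<not> closed_sequent (g w)" "\<not> loaded (g w)"
proof -
  have "g w \<in> g ` S" using assms by blast
  then show *: "basic (g w)" "unl ` g w \<subseteq> C" "g w \<notin> W" unfolding g by auto
  then show l: "\<not> loaded (g w)" using not_loaded_basic by blast
  show "\<not> closed_sequent (g w)" using not_prover_step[OF *(3)] *(2) l by (simp add: prover_step_def)
qed

lemma S_obtain:
  assumes "basic \<Gamma>" "unl ` \<Gamma> \<subseteq> C" "\<Gamma> \<notin> W"
  obtains w where "w \<in> S" "g w = \<Gamma>"
proof -
  have "\<Gamma> \<in> g ` S" unfolding g using assms by blast
  then show ?thesis using that by blast
qed

lemma finite_C: "unl ` \<Gamma> \<subseteq> C \<Longrightarrow> finite \<Gamma>"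
  using finite_unl_vimage[OF C(1)] by (meson finite_subset image_subset_iff_subset_vimage)

text \<open>Each expansion of a sequent outside \<open>W\<close> has a child outside
  \<open>W\<close>. Weights decrease until a basic sequent is reached; this is a state, and
  derivability is passed back up from children to parent.\<close>

lemma free_to_state:
  assumes "\<not> loaded \<Gamma>" "unl ` \<Gamma> \<subseteq> C" "\<Gamma> \<notin> W"
  shows "\<exists>w\<in>S. \<forall>\<phi>. Free \<phi> \<in> \<Gamma> \<longrightarrow> D \<phi> w"
  using wf_mult[OF wf_less_than] assms
proof (induction "weights \<Gamma>" arbitrary: \<Gamma> rule: wf_induct_rule)
  case less
  show ?case
  proof (cases "basic \<Gamma>")
    case True
    then obtain w where "w \<in> S" "g w = \<Gamma>" using S_obtain less.prems by metis
    moreover have "der \<Gamma> \<phi>" if "Free \<phi> \<in> \<Gamma>" for \<phi>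
      using der.base[OF that] basic_Free[OF less.prems(1)] True that by blast
    ultimately show ?thesis by blast
  next
    case False
    then obtain \<phi> where \<phi>: "Free \<phi> \<in> \<Gamma>" "\<not> basic {Free \<phi>}"
      using basic_Free[OF less.prems(1)] by blast
    obtain r G where r: "rule_inst r \<Gamma> G" "r \<notin> {RLPlus, RLMinus, RM}"
      and G: "\<forall>\<Gamma>'\<in>G. \<exists>Y. \<Gamma>' = (\<Gamma> - {Free \<phi>}) \<union> Free ` Y \<and> (\<forall>\<Delta>. (\<forall>\<chi>\<in>Y. der \<Delta> \<chi>) \<longrightarrow> der \<Delta> \<phi>)"
      using expand_nonbasic[OF \<phi>] by blast
    obtain \<Gamma>' where \<Gamma>': "\<Gamma>' \<in> G" "\<Gamma>' \<notin> W"
      using not_prover_step[OF less.prems(3)] less.prems(1,2) r(1) unfolding prover_step_def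
        by blast
    obtain Y where Y: "\<Gamma>' = (\<Gamma> - {Free \<phi>}) \<union> Free ` Y" "\<forall>\<Delta>. (\<forall>\<chi>\<in>Y. der \<Delta> \<chi>) \<longrightarrow> der \<Delta> \<phi>"
      using bspec[OF G \<Gamma>'(1)] by blast
    have "\<not> loaded \<Gamma>'" using less.prems(1) unfolding Y(1) by (auto simp: loaded_def)
    then obtain w where w: "w \<in> S" "\<forall>\<phi>. Free \<phi> \<in> \<Gamma>' \<longrightarrow> D \<phi> w"
      using less.hyps[OF local_rule_decreases[OF r finite_C[OF less.prems(2)] \<Gamma>'(1)]]
        rule_inst_closure[OF r(1) \<Gamma>'(1) C(2) less.prems(2)] \<Gamma>'(2) by blast
    have "D \<phi> w" using Y w(2) by simp
    then have "\<forall>\<psi>. Free \<psi> \<in> \<Gamma> \<longrightarrow> D \<psi> w" using w(2) Y(1) by auto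
    then show ?thesis using w(1) by blast
  qed
qed

text \<open>Tests along the run are read as derivability, which is what a diamond unfolding
  supplies. For \<open>Plain\<close> the run is empty and both conditions concern the same
  state.\<close>

definition fulfilled :: "('p, 'a) sequent \<Rightarrow> ('p, 'a) lbox \<Rightarrow> bool" where
  "fulfilled \<Delta> \<xi> \<longleftrightarrow> (\<exists>w\<in>S. (\<forall>\<phi>. Free \<phi> \<in> \<Delta> \<longrightarrow> D \<phi> w) \<and>
     (\<exists>v. (w, v) \<in> rels S R D (progs \<xi>) \<and> D (Neg (core \<xi>)) v))"

definition unfulfilled :: "('p, 'a) sequent set" where
  "unfulfilled = {\<Delta> \<union> {Loaded \<alpha> \<xi>} | \<Delta> \<alpha> \<xi>.
     \<not> loaded \<Delta> \<and> unl ` (\<Delta> \<union> {Loaded \<alpha> \<xi>}) \<subseteq> C \<and> \<not> fulfilled \<Delta> (LBox \<alpha> \<xi>)}"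

text \<open>If a rule has used up the marked block, the sequent is free and
  \<open>free_to_state\<close> supplies the state.\<close>

lemma fulfilledI:
  assumes "\<not> loaded \<Delta>" "unl ` (\<Delta> \<union> {lneg \<xi>}) \<subseteq> C" "\<Delta> \<union> {lneg \<xi>} \<notin> W" "\<Delta> \<union> {lneg \<xi>} \<notin> unfulfilled"
  shows "fulfilled \<Delta> \<xi>"
proof (cases \<xi>)
  case (Plain \<phi>)
  then have "\<not> loaded (\<Delta> \<union> {lneg \<xi>})" using assms(1) by simp
  then obtain w where "w \<in> S" "\<forall>\<psi>. Free \<psi> \<in> \<Delta> \<union> {lneg \<xi>} \<longrightarrow> D \<psi> w"
    using free_to_state assms(2,3) by blast
  then show ?thesis using Plain unfolding fulfilled_def by auto
next
  case (LBox \<alpha> \<zeta>)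
  then show ?thesis using assms unfolding unfulfilled_def by auto
qed

text \<open>At an unfulfilled basic sequent the prover unloads if that wins, and takes the modal step
  otherwise: in that case the unloaded sequent is itself a state of the model.\<close>

lemma unfulfilled_prover_loaded: "unfulfilled \<subseteq> prover_loaded W"
proof
  fix \<Lambda> assume "\<Lambda> \<in> unfulfilled"
  then show "\<Lambda> \<in> prover_loaded W"
  proof (coinduction arbitrary: \<Lambda> rule: prover_loaded.coinduct)
    case prover_loaded
    then obtain \<Delta> \<alpha> \<xi> where \<Lambda>: "\<Lambda> = \<Delta> \<union> {Loaded \<alpha> \<xi>}" and free: "\<not> loaded \<Delta>"
      and sub: "unl ` \<Lambda> \<subseteq> C" and nf: "\<not> fulfilled \<Delta> (LBox \<alpha> \<xi>)" unfolding unfulfilled_def by auto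
    have notin: "Loaded \<alpha> \<xi> \<notin> \<Delta>" using free by (auto simp: loaded_def)
    have "\<exists>r G. rule_inst r \<Lambda> G \<and> (\<forall>\<Gamma>\<in>G. \<Gamma> \<in> W \<or> \<Gamma> \<in> unfulfilled)"
    proof (cases "\<exists>\<phi>. Free \<phi> \<in> \<Delta> \<and> \<not> basic {Free \<phi>}")
      case True
      then obtain \<phi> where \<phi>: "Free \<phi> \<in> \<Delta>" "\<not> basic {Free \<phi>}" by blast
      then have \<phi>\<Lambda>: "Free \<phi> \<in> \<Lambda>" using \<Lambda> by simp
      obtain r G where r: "rule_inst r \<Lambda> G"
        and G: "\<forall>\<Gamma>'\<in>G. \<exists>Y. \<Gamma>' = (\<Lambda> - {Free \<phi>}) \<union> Free ` Y \<and> (\<forall>\<Delta>. (\<forall>\<chi>\<in>Y. der \<Delta> \<chi>) \<longrightarrow> der \<Delta> \<phi>)"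
        using expand_nonbasic[OF \<phi>\<Lambda> \<phi>(2)] by blast
      have "\<Gamma>' \<in> unfulfilled" if \<Gamma>': "\<Gamma>' \<in> G" for \<Gamma>'
      proof -
        obtain Y where Y: "\<Gamma>' = (\<Lambda> - {Free \<phi>}) \<union> Free ` Y" "\<forall>\<Delta>. (\<forall>\<chi>\<in>Y. der \<Delta> \<chi>) \<longrightarrow> der \<Delta> \<phi>"
          using bspec[OF G \<Gamma>'] by blast
        let ?\<Delta>' = "(\<Delta> - {Free \<phi>}) \<union> Free ` Y"
        have eq: "\<Gamma>' = ?\<Delta>' \<union> {Loaded \<alpha> \<xi>}" unfolding Y(1) \<Lambda> by auto
        have "\<not> fulfilled ?\<Delta>' (LBox \<alpha> \<xi>)"
        proof
          assume "fulfilled ?\<Delta>' (LBox \<alpha> \<xi>)"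
          then obtain w v where w: "w \<in> S" "\<forall>\<psi>. Free \<psi> \<in> ?\<Delta>' \<longrightarrow> D \<psi> w"
            "(w, v) \<in> rels S R D (progs (LBox \<alpha> \<xi>))" "D (Neg (core (LBox \<alpha> \<xi>))) v"
            unfolding fulfilled_def by blast
          have "D \<phi> w" using Y(2) w(2) by simp
          then have "\<forall>\<psi>. Free \<psi> \<in> \<Delta> \<longrightarrow> D \<psi> w" using w(2) by auto
          then show False using nf w(1,3,4) unfolding fulfilled_def by blast
        qed
        moreover have "\<not> loaded ?\<Delta>'" using free by (auto simp: loaded_def)
        moreover have "unl ` \<Gamma>' \<subseteq> C" by (rule rule_inst_closure[OF r \<Gamma>' C(2) sub])
        ultimately show ?thesis unfolding unfulfilled_def eq by blast
      qed
      then show ?thesis using r by blast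
    next
      case False
      then have bas: "basic \<Delta>" using basic_Free[OF free] by blast
      show ?thesis
      proof (cases "atomic \<alpha>")
        case nonatomic: False
        let ?G = "{\<Delta> \<union> \<Gamma> | \<Gamma>. \<Gamma> \<in> unfold_ldia \<alpha> \<xi>}"
        have r: "rule_inst RLDia \<Lambda> ?G" unfolding \<Lambda> by (rule rule_inst.ldia[OF notin nonatomic])
        have "\<Gamma>' \<in> W \<or> \<Gamma>' \<in> unfulfilled" if \<Gamma>': "\<Gamma>' \<in> ?G" for \<Gamma>'
        proof (rule ccontr)
          assume no: "\<not> (\<Gamma>' \<in> W \<or> \<Gamma>' \<in> unfulfilled)"
          obtain Y \<delta> where Y: "\<Gamma>' = (\<Delta> \<union> Free ` Y) \<union> {lneg (lboxes \<delta> \<xi>)}" "(Y, \<delta>) \<in> H \<alpha>"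
            using \<Gamma>' by (auto simp: unfold_ldia_def)
          have "fulfilled (\<Delta> \<union> Free ` Y) (lboxes \<delta> \<xi>)"
            by (rule fulfilledI)
              (use free no rule_inst_closure[OF r \<Gamma>' C(2) sub] in \<open>auto simp flip: Y(1) simp del: Un_insert_right\<close>)
          then obtain w v where w: "w \<in> S" "\<forall>\<psi>. Free \<psi> \<in> \<Delta> \<union> Free ` Y \<longrightarrow> D \<psi> w"
            "(w, v) \<in> rels S R D (\<delta> @ progs \<xi>)" "D (Neg (core \<xi>)) v"
            unfolding fulfilled_def by auto
          then obtain u where u: "(w, u) \<in> rels S R D \<delta>" "(u, v) \<in> rels S R D (progs \<xi>)"
            by (auto simp: rels_append)
          \<comment> \<open>The run through the unfolded list becomes a run of
            \<open>\<alpha>\<close>, which would fulfil the parent.\<close>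
          have "(w, u) \<in> rel S R D \<alpha>" by (rule H_sound[OF RS w(1) Y(2) _ u(1)]) (use w(2) in auto)
          then have "(w, v) \<in> rels S R D (progs (LBox \<alpha> \<xi>))" using u(2) by auto
          then show False using nf w(1,2,4) unfolding fulfilled_def by auto
        qed
        then show ?thesis using r by blast
      next
        case True
        then obtain a where a: "\<alpha> = Atom a" by (auto simp: atomic_def)
        define \<Gamma> where "\<Gamma> = \<Delta> \<union> {Free (Neg (Box (Atom a) (unl_box \<xi>)))}"
        have minus: "rule_inst RLMinus \<Lambda> {\<Gamma>}"
          using rule_inst.lminus[of "Atom a # progs \<xi>" "core \<xi>" \<Delta>] notin bas
          by (simp add: \<Lambda> \<Gamma>_def a lboxes_progs_core unl_box_eq)
        show ?thesis
        proof (cases "\<Gamma> \<in> W")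
          case True
          then show ?thesis using minus by blast
        next
          case nW: False
          have "basic \<Gamma>" using bas by (auto simp: \<Gamma>_def basic_def)
          moreover have "unl ` \<Gamma> \<subseteq> C" by (rule rule_inst_closure[OF minus _ C(2) sub]) simp
          ultimately obtain w where w: "w \<in> S" "g w = \<Gamma>" using S_obtain nW by metis
          have r: "rule_inst RM \<Lambda> {proj a \<Delta> \<union> {lneg \<xi>}}"
            unfolding \<Lambda> a by (rule rule_inst.modal) (use notin a bas in auto)
          have "proj a \<Delta> \<union> {lneg \<xi>} \<in> W \<or> proj a \<Delta> \<union> {lneg \<xi>} \<in> unfulfilled"
          proof (rule ccontr)
            assume no: "\<not> ?thesis"
            have "unl ` (proj a \<Delta> \<union> {lneg \<xi>}) \<subseteq> C"
              by (rule rule_inst_closure[OF r _ C(2) sub]) simp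
            then have "fulfilled (proj a \<Delta>) \<xi>" using no by (intro fulfilledI) auto
            then obtain w' v where w': "w' \<in> S" "\<forall>\<psi>. Free \<psi> \<in> proj a \<Delta> \<longrightarrow> D \<psi> w'"
              "(w', v) \<in> rels S R D (progs \<xi>)" "D (Neg (core \<xi>)) v"
              unfolding fulfilled_def by blast
            \<comment> \<open>The formula added to \<open>\<Delta>\<close> is a negation, so
              \<open>\<Gamma>\<close> has the same boxes and \<open>w'\<close> meets every demand
              made on a successor of \<open>w\<close>.\<close>
            have "(w, w') \<in> R a" using w w'(1,2) by (auto simp: R_def \<Gamma>_def proj_def)
            then have "(w, v) \<in> rels S R D (progs (LBox \<alpha> \<xi>))" using w'(3) a by auto
            moreover have "\<forall>\<psi>. Free \<psi> \<in> \<Delta> \<longrightarrow> D \<psi> w"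
              using w(2) False der.base[of _ \<Gamma>] by (auto simp: \<Gamma>_def)
            ultimately show False using nf w(1) w'(4) unfolding fulfilled_def by auto
          qed
          then show ?thesis using r by blast
        qed
      qed
    qed
    then obtain r G where r: "rule_inst r \<Lambda> G" "\<forall>\<Gamma>\<in>G. \<Gamma> \<in> W \<or> \<Gamma> \<in> unfulfilled" by blast
    have "loaded \<Lambda>" unfolding \<Lambda> by simp
    with r show ?case by (intro disjI2 exI[of _ \<Lambda>] exI[of _ r] exI[of _ G]) auto
  qed
qed

section \<open>Diamonds, boxes and truth in the model\<close>

lemma dia_atom:
  assumes w: "w \<in> S" and f: "Free (Neg (Box (Atom a) (boxes \<delta> \<phi>))) \<in> g w"
    and \<phi>: "\<nexists>\<beta> \<psi>. \<phi> = Box \<beta> \<psi>"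
  shows "\<exists>v. (w, v) \<in> rels S R D (Atom a # \<delta>) \<and> D (Neg \<phi>) v"
proof -
  let ?f = "Free (Neg (Box (Atom a) (boxes \<delta> \<phi>)))"
  let ?\<xi> = "lboxes \<delta> (Plain \<phi>)"
  define \<Delta> where "\<Delta> = g w - {?f}"
  have eq: "g w = \<Delta> \<union> {?f}" "?f \<notin> \<Delta>" using f by (auto simp: \<Delta>_def)
  have bas: "basic \<Delta>" using S_D(1)[OF w] by (auto simp: \<Delta>_def basic_def)
  have free: "\<not> loaded \<Delta>" using bas not_loaded_basic by blast
  let ?\<Lambda> = "\<Delta> \<union> {Loaded (Atom a) ?\<xi>}"
  have plus: "rule_inst RLPlus (g w) {?\<Lambda>}"
    unfolding eq(1) by (rule rule_inst.lplus[OF eq(2) free bas \<phi>])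
  \<comment> \<open>The label of a state is not won, hence neither is the result of (L+) nor that of
    (M) after it. A position that is not won is fulfilled, since unfulfilled loaded sequents are all
    won.\<close>
  have "?\<Lambda> \<notin> prover_loaded W"
    using not_prover_step[OF S_D(3)[OF w]] S_D(2,5)[OF w] plus unfolding prover_step_def by blast
  moreover have r: "rule_inst RM ?\<Lambda> {proj a \<Delta> \<union> {lneg ?\<xi>}}"
    by (rule rule_inst.modal[OF _ bas]) (use free in \<open>auto simp: loaded_def\<close>)
  ultimately have no: "proj a \<Delta> \<union> {lneg ?\<xi>} \<notin> W" "proj a \<Delta> \<union> {lneg ?\<xi>} \<notin> prover_loaded W"
    using prover_loaded.rule[OF _ r, of W] by auto
  have \<Lambda>C: "unl ` ?\<Lambda> \<subseteq> C" by (rule rule_inst_closure[OF plus _ C(2) S_D(2)[OF w]]) simp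
  have "unl ` (proj a \<Delta> \<union> {lneg ?\<xi>}) \<subseteq> C" by (rule rule_inst_closure[OF r _ C(2) \<Lambda>C]) simp
  then have "fulfilled (proj a \<Delta>) ?\<xi>"
    using no unfulfilled_prover_loaded by (intro fulfilledI) auto
  then obtain u v where u: "u \<in> S" "\<forall>\<psi>. Free \<psi> \<in> proj a \<Delta> \<longrightarrow> D \<psi> u"
    "(u, v) \<in> rels S R D \<delta>" "D (Neg \<phi>) v"
    unfolding fulfilled_def by auto
  have "(w, u) \<in> R a" using w u(1,2) by (auto simp: R_def proj_def \<Delta>_def)
  then have "(w, v) \<in> rels S R D (Atom a # \<delta>)" using u(3) by auto
  then show ?thesis using u(4) by blast
qed

text \<open>The first program is unfolded locally. An empty list leaves a shorter block at the same
  state. A nonempty list starts with an atomic program, and \<open>dia_atom\<close> realises the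
  entire remaining block at once; so induction on the length of the block suffices even in the
  presence of iterations.\<close>

lemma dia_boxes:
  assumes "w \<in> S" "D (Neg (boxes \<delta> \<phi>)) w" and \<phi>: "\<nexists>\<beta> \<psi>. \<phi> = Box \<beta> \<psi>"
  shows "\<exists>v. (w, v) \<in> rels S R D \<delta> \<and> D (Neg \<phi>) v"
  using assms(1,2)
proof (induction \<delta> arbitrary: w)
  case Nil
  then show ?case by simp
next
  case (Cons \<alpha> \<delta>)
  show ?case
  proof (cases "atomic \<alpha>")
    case True
    then obtain a where "\<alpha> = Atom a" by (auto simp: atomic_def)
    then show ?thesis
      using der_inversions(8)[of "g w" a] dia_atom[OF Cons.prems(1) _ \<phi>] Cons.prems(2) by simp
  next
    case False
    obtain Y \<eta> where Y: "(Y, \<eta>) \<in> H \<alpha>" "\<forall>\<chi>\<in>Y. D \<chi> w" "D (Neg (boxes \<eta> (boxes \<delta> \<phi>))) w"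
      by (rule der_dia_cases[OF _ False]) (use Cons.prems(2) in auto)
    have "\<exists>v. (w, v) \<in> rels S R D (\<eta> @ \<delta>) \<and> D (Neg \<phi>) v"
    proof (cases "\<eta> = []")
      case True
      then show ?thesis using Cons.IH[OF Cons.prems(1)] Y(3) by simp
    next
      case False
      then obtain a \<theta> where \<eta>: "\<eta> = Atom a # \<theta>" using H_head[OF Y(1)] by blast
      then have "Free (Neg (Box (Atom a) (boxes (\<theta> @ \<delta>) \<phi>))) \<in> g w"
        using der_inversions(8)[of "g w" a "boxes (\<theta> @ \<delta>) \<phi>"] Y(3) by simp
      from dia_atom[OF Cons.prems(1) this \<phi>] show ?thesis unfolding \<eta> by simp
    qed
    then obtain u v where u: "(w, u) \<in> rels S R D \<eta>" "(u, v) \<in> rels S R D \<delta>" "D (Neg \<phi>) v"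
      by (auto simp: rels_append)
    have "(w, u) \<in> rel S R D \<alpha>" by (rule H_sound[OF RS Cons.prems(1) Y(1,2) u(1)])
    then show ?thesis using u(2,3) by auto
  qed
qed

lemma box_rel:
  assumes "(w, v) \<in> rel S R (\<lambda>\<tau> w. \<not> D (Neg \<tau>) w) \<alpha>" "D (Box \<alpha> \<psi>) w"
  shows "D \<psi> v"
  using assms
proof (induction \<alpha> arbitrary: w v \<psi> rule: prog_induct)
  case (Atom a)
  then show ?case using der_inversions(7)[of "g w" a \<psi>] by (auto simp: R_def)
next
  case (Test \<tau>)
  obtain l where l: "\<And>\<chi>. \<chi> \<in> X l (Test \<tau>) \<psi> \<Longrightarrow> D \<chi> w" using der_box_cases[OF Test(2)] by blast
  \<comment> \<open>Otherwise \<open>Neg \<tau>\<close> would belong to the unfolding and be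
    derivable, and the test would not be passed in this relation.\<close>
  have "\<tau> \<in> l" using Test(1) l[of "Neg \<tau>"] by (auto simp: in_X_iff)
  then show ?case using Test(1) l[of \<psi>] by (auto simp: in_X_iff)
next
  case (Choice \<alpha> \<beta>)
  obtain l where l: "\<And>\<chi>. \<chi> \<in> X l (Choice \<alpha> \<beta>) \<psi> \<Longrightarrow> D \<chi> w"
    using der_box_cases[OF Choice.prems(2)] by blast
  have "X l \<alpha> \<psi> \<subseteq> X l (Choice \<alpha> \<beta>) \<psi>" "X l \<beta> \<psi> \<subseteq> X l (Choice \<alpha> \<beta>) \<psi>"
    by (auto simp: X_def F_def)
  then have "D (Box \<alpha> \<psi>) w" "D (Box \<beta> \<psi>) w"
    using l der_boxI[of l \<alpha> \<psi>] der_boxI[of l \<beta> \<psi>] by blast+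
  then show ?case using Choice.IH[of w v \<psi>] Choice.prems(1) by auto
next
  case (Seq \<alpha> \<beta>)
  obtain u where u: "(w, u) \<in> rel S R (\<lambda>\<tau> w. \<not> D (Neg \<tau>) w) \<alpha>"
    "(u, v) \<in> rel S R (\<lambda>\<tau> w. \<not> D (Neg \<tau>) w) \<beta>" using Seq.prems(1) by auto
  show ?case
    by (rule Seq.IH(2)[OF u(2) Seq.IH(1)[OF u(1) der_box_Seq[OF Seq.prems(2)]]])
next
  case (Star \<alpha>)
  have "(w, v) \<in> (rel S R (\<lambda>\<tau> w. \<not> D (Neg \<tau>) w) \<alpha>)\<^sup>*" using Star.prems(1) by simp
  then have "D (Box (Star \<alpha>) \<psi>) v"
  proof (induction rule: rtrancl_induct)
    case (step u v)
    show ?case by (rule Star.IH[OF step.hyps(2) der_box_Star(2)[OF step.IH]])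
  qed (rule Star.prems(2))
  then show ?case by (rule der_box_Star(1))
qed

text \<open>Tests are smaller than the boxes containing them, so the induction hypothesis places the
  actual relation between the one used for diamonds and the one used for boxes.\<close>

lemma truth:
  assumes "w \<in> S"
  shows "D \<phi> w \<Longrightarrow> sat M \<phi> w" and "D (Neg \<phi>) w \<Longrightarrow> \<not> sat M \<phi> w"
proof -
  have "(D \<phi> w \<longrightarrow> sat M \<phi> w) \<and> (D (Neg \<phi>) w \<longrightarrow> \<not> sat M \<phi> w)"
    using assms
  proof (induction \<phi> arbitrary: w rule: measure_induct_rule[of size])
    case (less \<phi>)
    have IH: "D \<psi> v \<Longrightarrow> sat M \<psi> v" "D (Neg \<psi>) v \<Longrightarrow> \<not> sat M \<psi> v" if "size \<psi> < size \<phi>" "v \<in> S" for \<psi> v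
      using less.IH[OF that] by auto
    have nc: "Free Bot \<notin> g w" "\<And>\<psi>. Free \<psi> \<in> g w \<Longrightarrow> Free (Neg \<psi>) \<notin> g w"
      using S_D(4)[OF less.prems] unfolding closed_sequent_def by blast+
    show ?case
    proof (cases \<phi>)
      case Bot
      then show ?thesis using nc(1) der_inversions(1)[of "g w"] by auto
    next
      case (Var p)
      then show ?thesis
        using nc(2)[of "Var p"] der_inversions(2,3)[of "g w" p] less.prems by (auto simp: M_def)
    next
      case (Neg \<psi>)
      then show ?thesis using IH[of \<psi> w] less.prems der_inversions(4)[of "g w" \<psi>] by auto
    next
      case (Con \<psi> \<chi>)
      then show ?thesis
        using IH[of \<psi> w] IH[of \<chi> w] less.prems der_inversions(5,6)[of "g w" \<psi> \<chi>] by auto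
    next
      case (Box \<alpha> \<psi>)
      have "sat M \<phi> w" if d: "D \<phi> w"
      proof -
        have "rel S R (sat M) \<alpha> \<subseteq> rel S R (\<lambda>\<tau> w. \<not> D (Neg \<tau>) w) \<alpha>"
          by (rule rel_mono) (use IH(2) size_tests[of _ \<alpha>] Box in fastforce)
        then have "D \<psi> v \<and> v \<in> S" if "(w, v) \<in> prel M \<alpha>" for v
          using box_rel[of w v \<alpha> \<psi>] rel_in_states[OF RS, of "sat M" \<alpha>] d that
          unfolding Box prel_eq_rel by (auto simp: M_def)
        then show ?thesis using IH(1)[of \<psi>] unfolding Box by simp
      qed
      moreover have "\<not> sat M \<phi> w" if d: "D (Neg \<phi>) w"
      proof -
        \<comment> \<open>The run found for a diamond refutes the formula behind the maximal block,
          so all leading boxes are stripped at once. As \<open>\<phi>\<close> is a box, that formula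
          is smaller.\<close>
        obtain \<delta> \<chi> where s: "\<phi> = boxes \<delta> \<chi>" "\<nexists>\<beta> \<theta>. \<chi> = Box \<beta> \<theta>" using strip_boxes[of \<phi>] by blast
        then obtain v where v: "(w, v) \<in> rels S R D \<delta>" "D (Neg \<chi>) v"
          using dia_boxes[OF less.prems, of \<delta> \<chi>] d by auto
        have vS: "v \<in> S" by (rule rels_in_states[OF RS v(1) less.prems])
        have "rels S R D \<delta> \<subseteq> rels S R (sat M) \<delta>"
        proof (rule rels_mono)
          fix \<beta> \<tau> w assume "\<beta> \<in> set \<delta>" "\<tau> \<in> tests \<beta>" "w \<in> S" "D \<tau> w"
          then show "sat M \<tau> w"
            using IH(1)[of \<tau> w] size_tests[of \<tau> \<beta>] size_boxes(2)[of \<beta> \<delta> \<chi>] s(1) by simp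
        qed
        then have "(w, v) \<in> prels M \<delta>" using v(1) by (auto simp: M_def)
        moreover have "size \<chi> < size \<phi>"
          using s Box by (cases \<delta>) (auto intro: le_imp_less_Suc size_boxes(1) trans_le_add2)
        then have "\<not> sat M \<chi> v" using IH(2)[of \<chi> v] v(2) vS by blast
        ultimately show ?thesis unfolding s(1) sat_boxes by blast
      qed
      ultimately show ?thesis by blast
    qed
  qed
  then show "D \<phi> w \<Longrightarrow> sat M \<phi> w" "D (Neg \<phi>) w \<Longrightarrow> \<not> sat M \<phi> w" by auto
qed

lemma free_satisfiable:
  assumes "Free ` \<Phi> \<notin> W" "\<Phi> \<subseteq> C"
  shows "satisfiable TYPE('w) \<Phi>"
proof -
  have "unl ` Free ` \<Phi> \<subseteq> C" using assms(2) by (simp add: image_image)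
  then obtain w where w: "w \<in> S" "\<forall>\<phi>. Free \<phi> \<in> Free ` \<Phi> \<longrightarrow> D \<phi> w"
    using free_to_state[of "Free ` \<Phi>"] assms(1) by auto
  have "kripke_model M" using w(1) RS by (auto simp: kripke_model_def M_def)
  moreover have "w \<in> states M" using w(1) by (simp add: M_def)
  moreover have "\<forall>\<phi>\<in>\<Phi>. sat M \<phi> w" using truth(1)[OF w(1)] w(2) by blast
  ultimately show ?thesis unfolding satisfiable_def by blast
qed

end

section \<open>Transfer to an arbitrary infinite type\<close>

lemma consistent_imp_satisfiable:
  fixes \<Phi> :: "('p, 'a) fm set"
  assumes "finite \<Phi>" "infinite (UNIV :: 'w set)" "consistent \<Phi>"
  shows "satisfiable TYPE('w) \<Phi>"
proof -
  obtain C where Cl: "finite C" "\<Phi> \<subseteq> C" "rule_closed C"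
    using rule_closed_superset[OF assms(1)] by blast
  obtain n where n: "prover_step C (prover_stage C n) = prover_stage C n"
    using prover_stage_stable[OF Cl(1)] by blast
  let ?B = "{\<Gamma>. basic \<Gamma> \<and> unl ` \<Gamma> \<subseteq> C \<and> \<Gamma> \<notin> prover_stage C n}"
  have "?B \<subseteq> Pow (unl -` C)" by auto
  then have fin: "finite ?B" using finite_unl_vimage[OF Cl(1)] finite_subset by blast
  \<comment> \<open>Only finitely many basic sequents occur as labels, so an infinite type has
    enough points to name each of them once.\<close>
  obtain S :: "'w set" where S: "finite S" "card S = card ?B"
    using infinite_arbitrarily_large[OF assms(2), of "card ?B"] by blast
  obtain g where g: "bij_betw g S ?B" using finite_same_card_bij[OF S(1) fin S(2)] by blast
  interpret builder C "prover_stage C n" S g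
    by (rule builder.intro[OF Cl(1,3) eq_refl[OF n] bij_betw_imp_surj_on[OF g]])
  have "Free ` \<Phi> \<notin> prover_stage C n"
    using closed_tableau_exists[of "Free ` \<Phi>" C n] assms(1,3) unfolding consistent_def by blast
  then show ?thesis by (rule free_satisfiable[OF _ Cl(2)])
qed

theorem theorem4p11:
  fixes \<Phi> :: "('p, 'a) fm set"
  assumes "finite \<Phi>"
    and "infinite (UNIV :: 'w set)"
  shows "consistent \<Phi> \<longleftrightarrow> satisfiable TYPE('w) \<Phi>"
  by (rule iffI[OF consistent_imp_satisfiable[OF assms] satisfiable_imp_consistent[OF assms(1)]])

end
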